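(* Let $x=(x_1,x_2,x_3)\in\mathrm{Hol}(\mathbb{D},\overline{\mathcal{E}})$. There exists a unique function $F=\begin{bmatrix}F_{ij}\end{bmatrix}_{i,j=1}^2\in\mathcal{S}^{2\times2}$ such that $$x=(F_{11},F_{22},\det F),$$ and $|F_{12}|=|F_{21}|$ almost everywhere on $\mathbb{T}$, $F_{21}$ is either $0$ or outer, and $F_{21}(0)\ge0$. Moreover, for all $\mu,\lambda\in\mathbb{D}$ and all $w,z\in\mathbb{C}$ such that $1-F_{22}(\mu)w\neq0$ and $1-F_{22}(\lambda)z\neq0$, $$1-\overline{\Psi(w,x(\mu))}\,\Psi(z,x(\lambda))=(1-\overline{w}z)\,\overline{\gamma(\mu,w)}\,\gamma(\lambda,z)+\eta(\mu,w)^*\bigl(I-F(\mu)^*F(\lambda)\bigr)\eta(\lambda,z),$$ where $$\gamma(\lambda,z)=(1-F_{22}(\lambda)z)^{-1}F_{21}(\lambda)\quad\text{and}\quad\eta(\lambda,z)=\begin{bmatrix}1\\ z\gamma(\lambda,z)\end{bmatrix}.$$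
   Context: $\mathbb{D}$ is the open unit disc and $\mathbb{T}$ the unit circle. The closed tetrablock is $\overline{\mathcal{E}}=\{(x_1,x_2,x_3)\in\mathbb{C}^3:1-x_1z-x_2w+x_3zw\neq 0\text{ for all }z,w\in\mathbb{D}\}$; $\mathrm{Hol}(\mathbb{D},\overline{\mathcal{E}})$ is the set of analytic maps from $\mathbb{D}$ to $\overline{\mathcal{E}}$. $\mathcal{S}^{2\times2}$ is the set of analytic $2\times2$ matrix functions $F$ on $\mathbb{D}$ with $\|F(\lambda)\|\le1$ (operator norm) for all $\lambda\in\mathbb{D}$. Values on $\mathbb{T}$ are radial limits, which exist a.e. "Outer" is in the usual sense for $H^\infty(\mathbb{D})$. $\Psi(z,x_1,x_2,x_3)=\dfrac{x_3z-x_1}{x_2z-1}$ for $x_2z\neq1$. *)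

theory Defs
  imports "HOL-Analysis.Analysis"
begin

definition closed_tetrablock :: "(complex^3) set" where
  "closed_tetrablock =
     {x. \<forall>z\<in>ball 0 1. \<forall>w\<in>ball 0 1. 1 - x$1 * z - x$2 * w + x$3 * z * w \<noteq> 0}"

text \<open>Maps on the disc are represented by total functions on \<open>complex\<close>; only their values on
  \<open>ball 0 1\<close> are meaningful.\<close>

definition Hol_tetrablock :: "(complex \<Rightarrow> complex^3) set" where
  "Hol_tetrablock =
     {x. (\<forall>i. (\<lambda>l. x l $ i) holomorphic_on ball 0 1) \<and> x ` ball 0 1 \<subseteq> closed_tetrablock}"

text \<open>The norm of \<open>complex^2\<close> is the Euclidean one, so \<open>onorm\<close> is the usual operator norm.\<close>

definition schur_class :: "(complex \<Rightarrow> complex^2^2) set" where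
  "schur_class =
     {F. (\<forall>i j. (\<lambda>l. F l $ i $ j) holomorphic_on ball 0 1) \<and>
         (\<forall>l\<in>ball 0 1. onorm ((*v) (F l)) \<le> 1)}"

text \<open>The value at a unimodular \<open>u\<close> of a function on the disc. For bounded holomorphic functions
  the limit exists for almost every \<open>u\<close>; \<open>Lim\<close> is unspecified where there is no limit.\<close>

definition radial_limit :: "(complex \<Rightarrow> complex) \<Rightarrow> complex \<Rightarrow> complex" where
  "radial_limit f u = Lim (at_left (1::real)) (\<lambda>r. f (of_real r * u))"

text \<open>The unit circle with arc-length measure is parametrised by \<open>t \<mapsto> cis t\<close>,
  \<open>0 \<le> t \<le> 2 * pi\<close>. A bounded holomorphic function is outer if it is a unimodular constant
  times the exponential of the Herglotz integral of \<open>ln \<phi>\<close>, for some positive \<open>\<phi>\<close> with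
  integrable logarithm. In particular the zero function is not outer.\<close>

definition outer :: "(complex \<Rightarrow> complex) \<Rightarrow> bool" where
  "outer f \<longleftrightarrow>
     f holomorphic_on ball 0 1 \<and> bounded (f ` ball 0 1) \<and>
     (\<exists>(c::complex) (\<phi>::real \<Rightarrow> real).
        cmod c = 1 \<and>
        (\<forall>t\<in>{0..2*pi}. \<phi> t > 0) \<and>
        \<phi> \<in> borel_measurable (lebesgue_on {0..2*pi}) \<and>
        integrable (lebesgue_on {0..2*pi}) (\<lambda>t. ln (\<phi> t)) \<and>
        (\<forall>z\<in>ball 0 1.
           f z = c * exp (1 / (2 * of_real pi) *
             (LINT t|lebesgue_on {0..2*pi}.
                (cis t + z) / (cis t - z) * of_real (ln (\<phi> t))))))"

definition tetrablock_lift :: "(complex \<Rightarrow> complex^3) \<Rightarrow> (complex \<Rightarrow> complex^2^2) \<Rightarrow> bool" where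
  "tetrablock_lift x F \<longleftrightarrow>
     F \<in> schur_class \<and>
     (\<forall>l\<in>ball 0 1. x l = vector [F l $ 1 $ 1, F l $ 2 $ 2, det (F l)]) \<and>
     (AE t in lebesgue_on {0..2*pi}.
        cmod (radial_limit (\<lambda>l. F l $ 1 $ 2) (cis t)) =
        cmod (radial_limit (\<lambda>l. F l $ 2 $ 1) (cis t))) \<and>
     ((\<forall>l\<in>ball 0 1. F l $ 2 $ 1 = 0) \<or> outer (\<lambda>l. F l $ 2 $ 1)) \<and>
     F 0 $ 2 $ 1 \<in> \<real>\<^sub>\<ge>\<^sub>0"

definition Psi :: "complex \<Rightarrow> complex^3 \<Rightarrow> complex" where
  "Psi z x = (x$3 * z - x$1) / (x$2 * z - 1)"

definition gamma_F :: "(complex \<Rightarrow> complex^2^2) \<Rightarrow> complex \<Rightarrow> complex \<Rightarrow> complex" where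
  "gamma_F F l z = inverse (1 - F l $ 2 $ 2 * z) * F l $ 2 $ 1"

definition eta_F :: "(complex \<Rightarrow> complex^2^2) \<Rightarrow> complex \<Rightarrow> complex \<Rightarrow> complex^2" where
  "eta_F F l z = vector [1, z * gamma_F F l z]"

definition conj_transpose :: "complex^'n^'m \<Rightarrow> complex^'m^'n" where
  "conj_transpose A = (\<chi> i j. cnj (A $ j $ i))"

text \<open>The scalar \<open>u\<^sup>* v\<close> for column vectors; the library's inner product on \<open>complex^'n\<close> is only
  its real part.\<close>

definition sesq :: "complex^'n \<Rightarrow> complex^'n \<Rightarrow> complex" where
  "sesq u v = (\<Sum>i\<in>UNIV. cnj (u $ i) * v $ i)"

end

theory Submission
  imports Defs "HOL-Complex_Analysis.Cauchy_Integral_Formula"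
begin

text \<open>
  Put \<open>f = x\<^sub>1 x\<^sub>2 - x\<^sub>3\<close>. A lift \<open>F\<close> has diagonal \<open>x\<^sub>1, x\<^sub>2\<close>, and its off-diagonal entries
  factor \<open>f\<close>; both vanish if \<open>f = 0\<close>. Otherwise equality of their moduli on the circle forces \<open>\<bar>F\<^sub>2\<^sub>1\<bar>\<^sup>2 = \<bar>f\<bar>\<close> there, so \<open>F\<^sub>2\<^sub>1\<close> is the
  outer function with boundary modulus \<open>\<bar>f\<bar>\<^sup>1\<^sup>/\<^sup>2\<close> and positive value at \<open>0\<close>, and \<open>F\<^sub>1\<^sub>2 = f / F\<^sub>2\<^sub>1\<close>.
  This outer function exists because \<open>ln \<bar>f\<bar>\<close> is integrable on the circle, and \<open>F\<^sub>1\<^sub>2\<close> is bounded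
  because \<open>\<bar>f\<bar> \<le> \<bar>F\<^sub>2\<^sub>1\<bar>\<^sup>2\<close> on the disc. On the circle \<open>F\<close> is a contraction, since points of the
  closed tetrablock satisfy \<open>2 \<bar>x\<^sub>1 x\<^sub>2 - x\<^sub>3\<bar> \<le> 1 - \<bar>x\<^sub>1\<bar>\<^sup>2 - \<bar>x\<^sub>2\<bar>\<^sup>2 + \<bar>x\<^sub>3\<bar>\<^sup>2\<close>; the maximum principle
  for the bounded functions \<open>w\<^sup>* F v\<close> carries this over to the disc. The final identity is the algebra
  of \<open>F \<eta> = (\<Psi>, \<gamma>)\<close>.
\<close>

section \<open>The Herglotz and Poisson kernels\<close>

text \<open>Every boundary argument rests on one fact: a bounded holomorphic function is the Poisson
  integral of its radial limits, which exist almost everywhere. L2 convergence along a sequence of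
  circles gives a boundary function, and Fatou's theorem at Lebesgue points then gives radial
  limits. The maximum principle and the estimates for outer functions are averages against the
  Poisson kernel.

  The tetrablock inequality yields a contraction for the following reason. If F has rows (a, b), (c,
  d) and |b| = |c|, the determinant of the identity minus (adjoint of F) F is 1 - |a|^2 - |d|^2 -
  2|bc| + |det F|^2, and the inequality says that this is nonnegative when x3 = det F. Inside the
  disc the moduli of the off-diagonal entries may differ, so the criterion is available only on the
  circle; hence the detour through boundary values.\<close>

abbreviation circ :: "real measure" where
  "circ \<equiv> lebesgue_on {0..2*pi}"

lemma finite_measure_circ: "finite_measure circ"
  by (rule finite_measure_lebesgue_on) auto

lemma integrable_circ_const: "integrable circ (\<lambda>t. c)"
  using finite_measure_circ finite_measure.integrable_const by blast

lemma measure_circ: "measure circ {0..2*pi} = 2*pi"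
  by (simp add: measure_restrict_space)

lemma integral_circ_const: "(LINT t|circ. (c::'a::{banach,second_countable_topology})) = (2*pi) *\<^sub>R c"
proof -
  have "space circ = {0..2*pi}" by simp
  then show ?thesis using measure_circ by (metis lebesgue_integral_const)
qed

lemma continuous_measurable_circ:
  fixes f :: "real \<Rightarrow> 'a::euclidean_space"
  assumes "continuous_on UNIV f"
  shows "f \<in> borel_measurable circ"
  by (meson assms continuous_imp_measurable_on_sets_lebesgue continuous_on_subset subset_UNIV lmeasurable_iff_integrable fmeasurableD lmeasurable_interval(1))

lemma integrable_circ_bounded:
  fixes f :: "real \<Rightarrow> 'a::euclidean_space"
  assumes "f \<in> borel_measurable circ" "\<And>t. t \<in> {0..2*pi} \<Longrightarrow> norm (f t) \<le> B"
  shows "integrable circ f"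
  by (rule Bochner_Integration.integrable_bound[OF integrable_circ_const[of B] assms(1)])
     (use assms(2) in \<open>auto intro!: AE_I2 intro: order_trans[OF _ abs_ge_self]\<close>)

lemma integrable_circ_mult_bounded:
  fixes f g :: "real \<Rightarrow> complex"
  assumes "integrable circ f" "g \<in> borel_measurable circ" "\<And>t. t \<in> {0..2*pi} \<Longrightarrow> cmod (g t) \<le> B"
  shows "integrable circ (\<lambda>t. g t * f t)"
proof (rule Bochner_Integration.integrable_bound)
  show "integrable circ (\<lambda>t. B * cmod (f t))" using assms(1) by simp
  show "(\<lambda>t. g t * f t) \<in> borel_measurable circ" using assms by measurable
  show "AE t in circ. norm (g t * f t) \<le> norm (B * cmod (f t))"
  proof (rule AE_I2)
    fix t assume "t \<in> space circ"
    then have "cmod (g t) \<le> B" by (intro assms(3)) simp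
    then have "cmod (g t) * cmod (f t) \<le> B * cmod (f t)" by (rule mult_right_mono) auto
    then show "norm (g t * f t) \<le> norm (B * cmod (f t))" by (simp add: norm_mult)
  qed
qed

lemma integral_cis_circ:
  fixes k :: int
  shows "(LINT t|circ. cis (of_int k * t)) = (if k = 0 then 2*pi else 0)"
proof (cases "k = 0")
  case True
  then show ?thesis using integral_circ_const[of "1::complex"] by (simp add: scaleR_conv_of_real )
next
  case False
  have int: "integrable circ (\<lambda>t. cis (of_int k * t))"
    by (rule integrable_circ_bounded[where B=1])
       (auto intro!: continuous_measurable_circ continuous_intros)
  have "((\<lambda>t. cis (of_int k * t)) has_integral
      (cis (of_int k * (2*pi)) / (\<i> * of_int k) - cis (of_int k * 0) / (\<i> * of_int k))) {0..2*pi}"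
  proof (rule fundamental_theorem_of_calculus)
    show "((\<lambda>t. cis (of_int k * t) / (\<i> * of_int k)) has_vector_derivative cis (of_int k * t)) (at t within {0..2*pi})"
      for t :: real
      using False
      by (auto intro!: derivative_eq_intros simp: has_vector_derivative_def has_real_derivative_iff_has_vector_derivative scaleR_conv_of_real field_simps fun_eq_iff)
  qed simp
  moreover have "cis (of_int k * (2*pi)) = 1"
    by (metis cis_multiple_2pi Ints_of_int mult.commute)
  ultimately have "integral {0..2*pi} (\<lambda>t. cis (of_int k * t)) = 0"
    by (auto simp: integral_unique)
  then show ?thesis using lebesgue_integral_eq_integral[OF int] False by simp
qed

lemma integral_cis_circ_nat:
  "(LINT t|circ. cis (real j * t) * cis (- (real k * t))) = (if j = k then 2*pi else 0)"
  using integral_cis_circ[of "int j - int k"] by (simp add: cis_mult algebra_simps)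

lemma integral_cis_circ_nat_add:
  "(LINT t|circ. cis (real j * t) * cis (real k * t)) = (if j = 0 \<and> k = 0 then 2*pi else 0)"
  using integral_cis_circ[of "int j + int k"] by (simp add: cis_mult algebra_simps)

lemma measurable_cis_circ [measurable]: "(\<lambda>t. cis (a * t)) \<in> borel_measurable circ"
  by (intro continuous_measurable_circ continuous_intros)

text \<open>Absolute summability of \<open>b\<close> and the bound \<open>B\<close> give an
  integrable majorant, so the series may be integrated term by term. It turns integrals of the
  Herglotz kernel, and of Taylor series on inner circles, into series of Fourier
  coefficients.\<close>

lemma sums_integral_circ:
  fixes b :: "nat \<Rightarrow> complex" and e :: "nat \<Rightarrow> real \<Rightarrow> complex"
  assumes b: "summable (\<lambda>k. norm (b k))"
    and e: "\<And>k. e k \<in> borel_measurable circ" "\<And>k t. cmod (e k t) \<le> B"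
    and g: "integrable circ g"
    and s: "\<And>t. t \<in> {0..2*pi} \<Longrightarrow> (\<lambda>k. b k * e k t) sums h t"
  shows "(\<lambda>k. b k * (LINT t|circ. e k t * g t)) sums (LINT t|circ. h t * g t)"
proof -
  have B: "0 \<le> B" using order_trans[OF norm_ge_zero e(2)] .
  have int: "integrable circ (\<lambda>t. e k t * g t)" for k
    by (rule integrable_circ_mult_bounded[OF g e(1) e(2)])
  have bd: "cmod (b k * (e k t * g t)) \<le> norm (b k) * (B * cmod (g t))" for k t
    by (simp add: norm_mult mult_left_mono mult_right_mono e(2))
  have "(\<lambda>k. LINT t|circ. b k * (e k t * g t)) sums (LINT t|circ. (\<Sum>k. b k * (e k t * g t)))"
  proof (rule sums_integral)
    show "integrable circ (\<lambda>t. b k * (e k t * g t))" for k using int by simp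
    show "AE t in circ. summable (\<lambda>k. cmod (b k * (e k t * g t)))"
      using bd by (intro AE_I2 summable_comparison_test'[OF summable_mult2[OF b]]) auto
    have "(LINT t|circ. cmod (b k * (e k t * g t))) \<le> norm (b k) * (B * (LINT t|circ. cmod (g t)))" for k
    proof -
      have "(LINT t|circ. cmod (b k * (e k t * g t))) \<le> (LINT t|circ. norm (b k) * (B * cmod (g t)))"
        using int g bd by (intro integral_mono) auto
      then show ?thesis by simp
    qed
    then show "summable (\<lambda>k. LINT t|circ. cmod (b k * (e k t * g t)))"
      by (intro summable_comparison_test'[OF summable_mult2[OF b]]) (auto simp: abs_of_nonneg)
  qed
  moreover have "(\<Sum>k. b k * (e k t * g t)) = h t * g t" if "t \<in> space circ" for t
    using sums_mult2[OF s, of t "g t"] that by (simp add: sums_unique[symmetric] mult.assoc)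
  then have "(LINT t|circ. (\<Sum>k. b k * (e k t * g t))) = (LINT t|circ. h t * g t)"
    by (intro Bochner_Integration.integral_cong) auto
  ultimately show ?thesis by simp
qed

text \<open>The kernel that \<open>outer\<close> writes out in full. Its real part is the Poisson
  kernel, so one power series serves both outer functions and boundary values.\<close>

definition herglotz :: "complex \<Rightarrow> real \<Rightarrow> complex" where
  "herglotz z t = (cis t + z) / (cis t - z)"

lemma cis_minus_nonzero: "cmod z < 1 \<Longrightarrow> cis t - z \<noteq> 0"
  by (metis eq_iff_diff_eq_0 norm_cis less_irrefl)

text \<open>With \<open>q = z * cis (- t)\<close> the kernel is \<open>2 / (1 - q) - 1\<close>, a
  geometric series; the subtracted 1 makes the coefficient at \<open>k = 0\<close> differ from the
  others.\<close>

lemma herglotz_sums: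
  assumes "cmod z < 1"
  shows "(\<lambda>k. ((if k = 0 then 1 else 2) * z^k) * cis (- (real k * t))) sums herglotz z t"
proof -
  define q where "q = z * cis (- t)"
  have q: "cmod q < 1" using assms by (simp add: q_def norm_mult)
  have 1: "(\<lambda>k. 2 * q^k - (if k = 0 then 1 else 0)) sums (2 * (1 / (1 - q)) - 1)"
    by (intro sums_diff sums_mult geometric_sums q sums_single[of 0 "\<lambda>_. 1::complex", simplified])
  have ne: "cis t - z \<noteq> 0" using cis_minus_nonzero[OF assms] .
  have "1 - q = (cis t - z) * cis (- t)" by (simp add: q_def algebra_simps cis_mult)
  moreover have "2 * (1 / (1 - q)) - 1 = (1 + q) / (1 - q)"
    using q by (cases "q = 1") (auto simp: field_simps)
  moreover have "1 + q = (cis t + z) * cis (- t)" by (simp add: q_def algebra_simps cis_mult)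
  ultimately have "2 * (1 / (1 - q)) - 1 = herglotz z t" by (simp add: herglotz_def)
  moreover have "q^k = z^k * cis (- (real k * t))" for k
    using Complex.DeMoivre[of "-t" k] by (simp add: q_def power_mult_distrib)
  then have "2 * q^k - (if k = 0 then 1 else 0) = ((if k = 0 then 1 else 2) * z^k) * cis (- (real k * t))" for k
    by (simp add: algebra_simps)
  ultimately show ?thesis using 1 by simp
qed

lemma herglotz_integral_sums:
  assumes z: "cmod z < 1" and g: "integrable circ g"
  shows "(\<lambda>k. ((if k = 0 then 1 else 2) * z^k) * (LINT t|circ. cis (- (real k * t)) * g t))
    sums (LINT t|circ. herglotz z t * g t)"
proof (rule sums_integral_circ[where B=1, OF _ _ _ g herglotz_sums[OF z]])
  have "summable (\<lambda>k. 2 * cmod z ^ k)"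
    using z by (intro summable_mult summable_geometric) auto
  then show "summable (\<lambda>k. cmod ((if k = 0 then 1 else 2) * z^k))"
    by (rule summable_comparison_test') (auto simp: norm_mult norm_power)
  show "(\<lambda>t. cis (- (real k * t))) \<in> borel_measurable circ" for k
    using measurable_cis_circ[of "- real k"] by simp
qed auto

lemma herglotz_integral_holomorphic:
  assumes g: "integrable circ g"
  shows "(\<lambda>z. LINT t|circ. herglotz z t * g t) holomorphic_on ball 0 1"
proof (rule power_series_holomorphic)
  fix w :: complex assume "w \<in> ball 0 1"
  then show "(\<lambda>k. ((if k = 0 then 1 else 2) * (LINT t|circ. cis (- (real k * t)) * g t)) * (w - 0)^k)
    sums (LINT t|circ. herglotz w t * g t)"
    using herglotz_integral_sums[OF _ g, of w] by (simp add: mult_ac)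
qed

definition poisson :: "complex \<Rightarrow> real \<Rightarrow> real" where
  "poisson z t = Re (herglotz z t)"

lemma poisson_eq:
  "poisson z t = (1 - (cmod z)\<^sup>2) / (cmod (cis t - z))\<^sup>2"
proof -
  have "Re ((cis t + z) * cnj (cis t - z)) = 1 - (cmod z)\<^sup>2"
    using sin_cos_squared_add[of t] unfolding cmod_power2 by (simp add: algebra_simps power2_eq_square)
  then show ?thesis unfolding poisson_def herglotz_def complex_div_cnj[of _ "cis t - z"]
    by (metis Re_divide_of_real)
qed

lemma poisson_nonneg: "cmod z < 1 \<Longrightarrow> 0 \<le> poisson z t"
  unfolding poisson_eq by (simp add: power_le_one)

lemma herglotz_bound:
  assumes "cmod z < 1"
  shows "cmod (herglotz z t) \<le> 2 / (1 - cmod z)"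
proof -
  have "cmod (cis t) - cmod z \<le> cmod (cis t - z)" by (rule norm_triangle_ineq2)
  moreover have "cmod (cis t + z) \<le> 2" using norm_triangle_ineq[of "cis t" z] assms by simp
  ultimately show ?thesis using assms unfolding herglotz_def norm_divide
    by (intro frac_le) auto
qed

lemma herglotz_measurable [measurable]:
  "cmod z < 1 \<Longrightarrow> herglotz z \<in> borel_measurable circ"
  unfolding herglotz_def using cis_minus_nonzero
  by (intro continuous_measurable_circ continuous_intros) auto

lemma poisson_measurable [measurable]:
  "cmod z < 1 \<Longrightarrow> poisson z \<in> borel_measurable circ"
  unfolding poisson_def by measurable

lemma poisson_bound: "cmod z < 1 \<Longrightarrow> poisson z t \<le> 2 / (1 - cmod z)"
  using herglotz_bound complex_Re_le_cmod order_trans unfolding poisson_def by blast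

lemma poisson_mult_integrable:
  fixes g :: "real \<Rightarrow> complex"
  assumes "cmod z < 1" "integrable circ g"
  shows "integrable circ (\<lambda>t. of_real (poisson z t) * g t)"
  using assms poisson_bound[of z] poisson_nonneg[of z]
  by (intro integrable_circ_mult_bounded[where B="2 / (1 - cmod z)"]) auto

lemma poisson_mult_integrable_real:
  fixes g :: "real \<Rightarrow> real"
  assumes "cmod z < 1" "integrable circ g"
  shows "integrable circ (\<lambda>t. poisson z t * g t)"
  using integrable_Re[OF poisson_mult_integrable[of z "\<lambda>t. of_real (g t)"]] assms by simp

text \<open>The Poisson kernel is half the sum of the Herglotz kernel and its conjugate. Moving the
  conjugation onto \<open>g\<close> leaves two Herglotz integrals, both accessible to
  \<open>herglotz_integral_sums\<close>.\<close>

lemma integral_poisson_complex: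
  fixes g :: "real \<Rightarrow> complex"
  assumes z: "cmod z < 1" and g: "integrable circ g"
  shows "(LINT t|circ. of_real (poisson z t) * g t) =
    ((LINT t|circ. herglotz z t * g t) + cnj (LINT t|circ. herglotz z t * cnj (g t))) / 2"
proof -
  have i1: "integrable circ (\<lambda>t. herglotz z t * g t)"
    using z g herglotz_bound[OF z] by (intro integrable_circ_mult_bounded) auto
  have i2: "integrable circ (\<lambda>t. herglotz z t * cnj (g t))"
    using z g herglotz_bound[OF z] by (intro integrable_circ_mult_bounded) auto
  have "complex_of_real (poisson z t) = (herglotz z t + cnj (herglotz z t)) / 2" for t
    by (simp add: poisson_def complex_add_cnj)
  then have "(LINT t|circ. of_real (poisson z t) * g t) =
    (LINT t|circ. (herglotz z t * g t + cnj (herglotz z t * cnj (g t))) / 2)"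
    by (intro Bochner_Integration.integral_cong) (auto simp: field_simps)
  also have "\<dots> = ((LINT t|circ. herglotz z t * g t) + (LINT t|circ. cnj (herglotz z t * cnj (g t)))) / 2"
    using i1 i2 by (simp del: complex_cnj_mult complex_cnj_cnj)
  finally show ?thesis by (simp only: Bochner_Integration.integral_cnj)
qed

lemma integral_poisson_real:
  fixes g :: "real \<Rightarrow> real"
  assumes z: "cmod z < 1" and g: "integrable circ g"
  shows "Re (LINT t|circ. herglotz z t * of_real (g t)) = (LINT t|circ. poisson z t * g t)"
proof -
  have i1: "integrable circ (\<lambda>t. herglotz z t * of_real (g t))"
    using z g herglotz_bound[OF z] by (intro integrable_circ_mult_bounded) auto
  show ?thesis using integral_Re[OF i1] by (simp add: poisson_def)
qed

lemma integral_poisson: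
  assumes z: "cmod z < 1"
  shows "(LINT t|circ. poisson z t) = 2*pi"
proof -
  have *: "(LINT t|circ. cis (- (real k * t))) = (if k = 0 then 2*pi else 0)" for k
    using integral_cis_circ_nat[of 0 k] by simp
  then have "(\<lambda>k. ((if k = 0 then 1 else 2) * z^k) * (if k = 0 then complex_of_real (2*pi) else 0))
    sums (LINT t|circ. herglotz z t * 1)"
    using herglotz_integral_sums[OF z integrable_circ_const[of "1::complex"]]
    unfolding mult_1_right * by (simp only: if_distrib[of complex_of_real] of_real_0)
  moreover have "(\<lambda>k. ((if k = 0 then 1 else 2) * z^k) * (if k = 0 then complex_of_real (2*pi) else 0))
    = (\<lambda>k. if k = 0 then complex_of_real (2*pi) else 0)" by (simp add: fun_eq_iff)
  ultimately have "(LINT t|circ. herglotz z t * 1) = complex_of_real (2*pi)"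
    using sums_unique2[OF _ sums_single[of 0 "\<lambda>_. complex_of_real (2*pi)"]] by metis
  then show ?thesis using integral_poisson_real[OF z, of "\<lambda>_. 1"] integrable_circ_const[of "1::real"] by simp
qed

section \<open>Radial limits of Poisson integrals\<close>

lemma integrable_norm_minus_const:
  fixes f :: "real \<Rightarrow> 'b::euclidean_space"
  assumes f: "\<And>a b. f absolutely_integrable_on {a..b}"
  shows "(\<lambda>s. norm (f s - q)) integrable_on cbox a b"
proof -
  have 1: "f absolutely_integrable_on cbox a b"
    using f by simp
  have 2: "(\<lambda>s. q) absolutely_integrable_on cbox a b"
    by (rule absolutely_integrable_on_const) auto
  from set_integral_diff(1)[OF 1 2] have "(\<lambda>s. f s - q) absolutely_integrable_on cbox a b" .
  then have "(\<lambda>s. norm (f s - q)) absolutely_integrable_on cbox a b"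
    using absolutely_integrable_norm by (force simp: o_def)
  then show ?thesis by (rule set_lebesgue_integral_eq_integral(1))
qed

text \<open>Differentiate the integrals of \<open>\<bar>f - q\<bar>\<close> for all \<open>q\<close> in a countable dense set.\<close>

lemma lebesgue_points_right:
  fixes f :: "real \<Rightarrow> 'b::euclidean_space"
  assumes f: "\<And>a b. f absolutely_integrable_on {a..b}"
  obtains N where "negligible N"
    "\<And>x e. \<lbrakk>x \<notin> N; 0 < e\<rbrakk> \<Longrightarrow>
       \<exists>d>0. \<forall>h. 0 < h \<and> h < d \<longrightarrow> integral {x..x+h} (\<lambda>s. norm (f s - f x)) \<le> e * h"
proof -
  have int: "(\<lambda>s. norm (f s - q)) integrable_on cbox a b" for q a b
    by (rule integrable_norm_minus_const[OF f])
  obtain D :: "'b set" where D: "countable D" "\<And>X. open X \<Longrightarrow> X \<noteq> {} \<Longrightarrow> \<exists>d\<in>D. d \<in> X"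
    using countable_dense_setE by blast
  have "\<exists>N. negligible N \<and> (\<forall>x e. x \<notin> N \<longrightarrow> 0 < e \<longrightarrow> (\<exists>d>0. \<forall>h. 0 < h \<and> h < d \<longrightarrow>
     \<bar>integral {x..x + h} (\<lambda>s. norm (f s - q)) / h - norm (f x - q)\<bar> < e))" for q
  \<comment> \<open>Lebesgue differentiation for the scalar function \<open>norm (f s - q)\<close>.
    The null set depends on \<open>q\<close>, so only countably many \<open>q\<close> can be treated
    at once.\<close>
  proof (rule integrable_ccontinuous_explicit[of "\<lambda>s. norm (f s - q)", OF int])
    fix N :: "real set"
    assume N: "negligible N" "\<And>x e. \<lbrakk>x \<notin> N; 0 < e\<rbrakk> \<Longrightarrow> \<exists>d>0. \<forall>h. 0 < h \<and> h < d \<longrightarrow>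
     norm (integral (cbox x (x + h *\<^sub>R One)) (\<lambda>s. norm (f s - q)) /\<^sub>R h ^ DIM(real) - norm (f x - q)) < e"
    show ?thesis
      using N by (intro exI[of _ N]) (simp add: divide_inverse mult.commute)
  qed
  then have "\<exists>N. \<forall>q. negligible (N q) \<and> (\<forall>x e. x \<notin> N q \<longrightarrow> 0 < e \<longrightarrow> (\<exists>d>0. \<forall>h. 0 < h \<and> h < d \<longrightarrow>
     \<bar>integral {x..x + h} (\<lambda>s. norm (f s - q)) / h - norm (f x - q)\<bar> < e))"
    by (intro choice allI)
  then obtain N where N: "\<And>q. negligible (N q)"
    "\<And>q x e. x \<notin> N q \<Longrightarrow> 0 < e \<Longrightarrow> (\<exists>d>0. \<forall>h. 0 < h \<and> h < d \<longrightarrow>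
     \<bar>integral {x..x + h} (\<lambda>s. norm (f s - q)) / h - norm (f x - q)\<bar> < e)"
    by blast
  show ?thesis
  proof (rule that)
    show "negligible (\<Union>q\<in>D. N q)"
      using N(1) D(1) by (intro negligible_countable_Union) auto
    fix x e :: real assume x: "x \<notin> (\<Union>q\<in>D. N q)" and e: "0 < e"
    obtain q where q: "q \<in> D" "dist (f x) q < e/4"
      using D(2)[of "ball (f x) (e/4)"] e by (auto simp: dist_commute)
    obtain d where d: "d > 0" "\<And>h. 0 < h \<Longrightarrow> h < d \<Longrightarrow>
      \<bar>integral {x..x + h} (\<lambda>s. norm (f s - q)) / h - norm (f x - q)\<bar> < e/4"
      using N(2)[of x q "e/4"] x q e by auto
    have "integral {x..x+h} (\<lambda>s. norm (f s - f x)) \<le> e * h" if h: "0 < h" "h < d" for h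
    proof -
      have c: "((\<lambda>s. norm (q - f x)) has_integral norm (q - f x) * h) {x..x+h}"
        using has_integral_const_real[of "norm (q - f x)" x "x+h"] h by (simp add: mult.commute)
      \<comment> \<open>Triangle inequality through \<open>q\<close>: the mean of
        \<open>norm (f s - q)\<close> costs at most \<open>e/4 + norm (f x - q)\<close>, and
        \<open>norm (q - f x)\<close> comes on top; the choice of \<open>q\<close> keeps the total
        below \<open>3 * e / 4\<close>.\<close>
      have "integral {x..x+h} (\<lambda>s. norm (f s - f x)) \<le> integral {x..x+h} (\<lambda>s. norm (f s - q) + norm (q - f x))"
        using int[of _ x "x+h"] c
        by (intro integral_le Henstock_Kurzweil_Integration.integrable_add norm_diff_triangle_le) (auto simp: integrable_on_def)
      also have "\<dots> = integral {x..x+h} (\<lambda>s. norm (f s - q)) + norm (q - f x) * h"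
        using int[of _ x "x+h"] c by (subst Henstock_Kurzweil_Integration.integral_add) (auto simp: integrable_on_def integral_unique)
      also have "\<dots> \<le> (e/4 + norm (f x - q)) * h + norm (q - f x) * h"
      proof -
        have "integral {x..x+h} (\<lambda>s. norm (f s - q)) / h \<le> e/4 + norm (f x - q)"
          using d(2)[OF h] by linarith
        then show ?thesis using h by (simp add: pos_divide_le_eq)
      qed
      also have "\<dots> \<le> (e/4 + e/4) * h + e/4 * h"
        using q(2) h by (intro add_mono mult_right_mono) (auto simp: dist_norm norm_minus_commute)
      also have "\<dots> \<le> e * h" using h e by (simp add: field_simps)
      finally show ?thesis .
    qed
    then show "\<exists>d>0. \<forall>h. 0 < h \<and> h < d \<longrightarrow> integral {x..x+h} (\<lambda>s. norm (f s - f x)) \<le> e * h"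
      using d(1) by blast
  qed
qed

text \<open>The left half of the interval is the one-sided result for the reflected function, whose
  exceptional set has to be reflected back.\<close>

lemma lebesgue_points:
  fixes f :: "real \<Rightarrow> 'b::euclidean_space"
  assumes f: "\<And>a b. f absolutely_integrable_on {a..b}"
  obtains N where "negligible N"
    "\<And>x e. \<lbrakk>x \<notin> N; 0 < e\<rbrakk> \<Longrightarrow>
       \<exists>d>0. \<forall>h. 0 < h \<and> h < d \<longrightarrow> integral {x-h..x+h} (\<lambda>s. norm (f s - f x)) \<le> e * h"
proof -
  have int: "(\<lambda>s. norm (f s - q)) integrable_on {a..b}" for q a b
    using integrable_norm_minus_const[OF f, of q a b] by simp
  obtain N1 where N1: "negligible N1" "\<And>x e. \<lbrakk>x \<notin> N1; 0 < e\<rbrakk> \<Longrightarrow>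
       \<exists>d>0. \<forall>h. 0 < h \<and> h < d \<longrightarrow> integral {x..x+h} (\<lambda>s. norm (f s - f x)) \<le> e * h"
    using lebesgue_points_right[OF f] by metis
  have "(\<lambda>s. f (- s)) absolutely_integrable_on {a..b}" for a b
    using absolutely_integrable_reflect_real[where f=f and a="-b" and b="-a"] f by simp
  then obtain N2 where N2: "negligible N2" "\<And>x e. \<lbrakk>x \<notin> N2; 0 < e\<rbrakk> \<Longrightarrow>
       \<exists>d>0. \<forall>h. 0 < h \<and> h < d \<longrightarrow> integral {x..x+h} (\<lambda>s. norm (f (-s) - f (-x))) \<le> e * h"
    using lebesgue_points_right[of "\<lambda>s. f (-s)"] by metis
  show ?thesis
  proof (rule that)
    show "negligible (N1 \<union> uminus ` N2)"
      by (intro negligible_Un N1(1) negligible_differentiable_image_negligible[OF _ N2(1)]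
          differentiable_on_minus differentiable_on_ident) simp
    fix x e :: real assume x: "x \<notin> N1 \<union> uminus ` N2" and e: "0 < e"
    then have x2: "- x \<notin> N2" by force
    obtain d1 where d1: "d1 > 0" "\<And>h. 0 < h \<Longrightarrow> h < d1 \<Longrightarrow> integral {x..x+h} (\<lambda>s. norm (f s - f x)) \<le> e/2 * h"
      using N1(2)[of x "e/2"] x e by auto
    obtain d2 where d2: "d2 > 0" "\<And>h. 0 < h \<Longrightarrow> h < d2 \<Longrightarrow> integral {-x..-x+h} (\<lambda>s. norm (f (-s) - f x)) \<le> e/2 * h"
      using N2(2)[OF x2, of "e/2"] e by auto
    have "integral {x-h..x+h} (\<lambda>s. norm (f s - f x)) \<le> e * h" if h: "0 < h" "h < min d1 d2" for h
    proof -
      have "integral {x-h..x+h} (\<lambda>s. norm (f s - f x)) =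
        integral {x-h..x} (\<lambda>s. norm (f s - f x)) + integral {x..x+h} (\<lambda>s. norm (f s - f x))"
        using h by (intro Henstock_Kurzweil_Integration.integral_combine[symmetric] int) auto
      also have "integral {x-h..x} (\<lambda>s. norm (f s - f x)) = integral {-x..-x+h} (\<lambda>s. norm (f (-s) - f x))"
        using Henstock_Kurzweil_Integration.integral_reflect_real[where a="x-h" and b=x and f="\<lambda>s. norm (f s - f x)"] by (simp add: algebra_simps)
      finally show ?thesis using d1(2)[of h] d2(2)[of h] h by (simp add: algebra_simps)
    qed
    then show "\<exists>d>0. \<forall>h. 0 < h \<and> h < d \<longrightarrow> integral {x-h..x+h} (\<lambda>s. norm (f s - f x)) \<le> e * h"
      using d1(1) d2(1) by (intro exI[of _ "min d1 d2"]) auto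
  qed
qed

section \<open>Size of the Poisson kernel near its peak and away from it\<close>

lemma one_minus_cos_ge:
  fixes x :: real
  assumes "\<bar>x\<bar> \<le> 1"
  shows "x\<^sup>2 / 4 \<le> 1 - cos x"
proof -
  \<comment> \<open>Since \<open>1 < pi/3\<close>, the cosine is at least \<open>1/2\<close> on the
    unit interval; comparing derivatives twice then gives the bounds \<open>y / 2\<close> for the
    sine and \<open>y^2 / 4\<close> for \<open>1 - cos y\<close>.\<close>
  have c: "1/2 \<le> cos y" if "0 \<le> y" "y \<le> 1" for y :: real
  proof -
    have "cos (pi/3) \<le> cos y" using that pi_gt3 by (intro cos_monotone_0_pi_le) auto
    then show ?thesis by (simp add: cos_60)
  qed
  have s: "y / 2 \<le> sin y" if "0 \<le> y" "y \<le> 1" for y :: real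
  proof -
    have "sin 0 - 0/2 \<le> sin y - y/2"
    proof (rule DERIV_nonneg_imp_nondecreasing[where f="\<lambda>u. sin u - u/2", OF that(1)])
      fix u assume "0 \<le> u" "u \<le> y"
      then show "\<exists>D. ((\<lambda>u. sin u - u/2) has_real_derivative D) (at u) \<and> 0 \<le> D"
        using c[of u] that by (intro exI[of _ "cos u - 1/2"]) (auto intro!: derivative_eq_intros)
    qed
    then show ?thesis by simp
  qed
  have "1 - cos 0 - 0\<^sup>2/4 \<le> 1 - cos \<bar>x\<bar> - \<bar>x\<bar>\<^sup>2/4"
  proof (rule DERIV_nonneg_imp_nondecreasing[where f="\<lambda>u. 1 - cos u - u\<^sup>2/4"])
    fix u assume "0 \<le> u" "u \<le> \<bar>x\<bar>"
    then show "\<exists>D. ((\<lambda>u. 1 - cos u - u\<^sup>2/4) has_real_derivative D) (at u) \<and> 0 \<le> D"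
      using s[of u] assms by (intro exI[of _ "sin u - u/2"]) (auto intro!: derivative_eq_intros)
  qed simp
  then show ?thesis by simp
qed

lemma norm_cis_minus_sq:
  "(cmod (cis s - of_real r * cis t))\<^sup>2 = (1 - r)\<^sup>2 + 2 * r * (1 - cos (s - t))"
proof -
  have "(cmod (cis s - of_real r * cis t))\<^sup>2 = (cos s - r * cos t)\<^sup>2 + (sin s - r * sin t)\<^sup>2"
    by (simp add: cmod_power2)
  also have "\<dots> = ((cos s)\<^sup>2 + (sin s)\<^sup>2) + r\<^sup>2 * ((cos t)\<^sup>2 + (sin t)\<^sup>2) - 2 * r * (cos s * cos t + sin s * sin t)"
    by algebra
  also have "\<dots> = 1 + r\<^sup>2 - 2 * r * cos (s - t)"
    by (simp only: sin_cos_squared_add2 cos_diff)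
  finally show ?thesis by (simp add: power2_eq_square algebra_simps)
qed

lemma poisson_radial_eq:
  assumes "0 \<le> r"
  shows "poisson (of_real r * cis t) s = (1 - r\<^sup>2) / ((1 - r)\<^sup>2 + 2 * r * (1 - cos (s - t)))"
  unfolding poisson_eq norm_cis_minus_sq using assms by (simp add: norm_mult)

text \<open>The numerator is at most \<open>2 * (1 - r)\<close>; \<open>r \<ge> 1/2\<close> and
  \<open>one_minus_cos_ge\<close> bound the denominator below by a quarter of
  \<open>(1 - r)^2 + (s - t)^2\<close>. Hence the factor 8.\<close>

lemma poisson_bound_near:
  assumes r: "1/2 \<le> r" "r < 1" and s: "\<bar>s - t\<bar> \<le> 1"
  shows "poisson (of_real r * cis t) s \<le> 8 * (1 - r) / ((1 - r)\<^sup>2 + (s - t)\<^sup>2)"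
proof -
  have r0: "0 \<le> r" using r by simp
  have "((1 - r)\<^sup>2 + (s - t)\<^sup>2) / 4 \<le> (1 - r)\<^sup>2 + 1 * ((s - t)\<^sup>2 / 4)"
    by simp
  also have "\<dots> \<le> (1 - r)\<^sup>2 + 2 * r * (1 - cos (s - t))"
    using r one_minus_cos_ge[OF s] by (intro add_left_mono mult_mono) auto
  finally have "((1 - r)\<^sup>2 + (s - t)\<^sup>2) / 4 \<le> (1 - r)\<^sup>2 + 2 * r * (1 - cos (s - t))" .
  moreover have "1 - r\<^sup>2 \<le> 2 * (1 - r)" using zero_le_power2[of "1 - r"] by (simp add: power2_eq_square algebra_simps)
  moreover have "0 < (1 - r)\<^sup>2 + (s - t)\<^sup>2" using r by (simp add: sum_power2_gt_zero_iff)
  ultimately have "poisson (of_real r * cis t) s \<le> (2 * (1 - r)) / (((1 - r)\<^sup>2 + (s - t)\<^sup>2) / 4)"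
    unfolding poisson_radial_eq[OF r0] using r
    by (intro frac_le) auto
  then show ?thesis by simp
qed

lemma cos_le_away:
  assumes "0 \<le> d" "d \<le> pi" "d \<le> x" "x \<le> 2*pi - d"
  shows "cos x \<le> cos d"
proof (cases "x \<le> pi")
  case True
  then show ?thesis using assms by (intro cos_monotone_0_pi_le) auto
next
  case False
  then have "cos (2*pi - x) \<le> cos d" using assms by (intro cos_monotone_0_pi_le) auto
  then show ?thesis by simp
qed

text \<open>The bounds on \<open>t\<close> keep \<open>\<bar>s - t\<bar>\<close> between
  \<open>d\<close> and \<open>2*pi - d\<close>, so \<open>s\<close> is at distance at least
  \<open>d\<close> from \<open>t\<close> around the circle as well. The bound vanishes uniformly in
  \<open>s\<close> as \<open>r\<close> tends to 1.\<close>

lemma poisson_bound_far: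
  assumes r: "1/2 \<le> r" "r < 1" and d: "0 < d" "d \<le> pi" "d \<le> t" "t \<le> 2*pi - d"
    and s: "0 \<le> s" "s \<le> 2*pi" "d \<le> \<bar>s - t\<bar>"
  shows "poisson (of_real r * cis t) s \<le> 2 * (1 - r) / (1 - cos d)"
proof -
  have r0: "0 \<le> r" using r by simp
  have "cos (s - t) = cos \<bar>s - t\<bar>" by simp
  also have "\<dots> \<le> cos d" using d s by (intro cos_le_away) auto
  finally have "cos (s - t) \<le> cos d" .
  moreover have "cos d < cos 0" using d by (intro cos_monotone_0_pi) auto
  ultimately have c: "0 < 1 - cos d" "1 - cos d \<le> 1 - cos (s - t)" by auto
  then have "1 * (1 - cos d) \<le> 2 * r * (1 - cos (s - t))" using r by (intro mult_mono) auto
  then have "1 - cos d \<le> (1 - r)\<^sup>2 + 2 * r * (1 - cos (s - t))"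
    using add_mono[OF zero_le_power2[of "1 - r"]] by fastforce
  moreover have "1 - r\<^sup>2 \<le> 2 * (1 - r)" using zero_le_power2[of "1 - r"] by (simp add: power2_eq_square algebra_simps)
  ultimately show ?thesis unfolding poisson_radial_eq[OF r0] using c r
    by (intro frac_le) auto
qed

text \<open>Bounds the Poisson kernel near its peak by averages over dyadic intervals.\<close>

lemma dyadic_bound:
  fixes x d \<delta> :: real
  assumes d: "0 < d" and x: "\<bar>x\<bar> \<le> \<delta>" "\<delta> \<le> 2^J * d"
  shows "1 / (d\<^sup>2 + x\<^sup>2) \<le> (\<Sum>j\<le>J. 4 / (4^j * d\<^sup>2) * of_bool (\<bar>x\<bar> \<le> min (2^j * d) \<delta>))"
    (is "_ \<le> (\<Sum>j\<le>J. ?f j)")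
proof -
  have ex: "\<bar>x\<bar> \<le> 2^J * d" using x by linarith
  \<comment> \<open>The first dyadic scale that reaches \<open>x\<close>. By minimality
    \<open>x\<close> lies beyond half of that scale when \<open>j > 0\<close>, so the single summand
    \<open>j\<close> already dominates the left-hand side.\<close>
  define j where "j = (LEAST j. \<bar>x\<bar> \<le> 2^j * d)"
  have j: "\<bar>x\<bar> \<le> 2^j * d" unfolding j_def using ex by (rule LeastI)
  have jJ: "j \<le> J" unfolding j_def using ex by (rule Least_le)
  have "1 / (d\<^sup>2 + x\<^sup>2) \<le> 4 / (4^j * d\<^sup>2)"
  proof (cases j)
    case 0
    have "1 / (d\<^sup>2 + x\<^sup>2) \<le> 4 / d\<^sup>2" using d by (intro frac_le) auto
    then show ?thesis unfolding 0 by simp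
  next
    case (Suc i)
    have "\<not> \<bar>x\<bar> \<le> 2^i * d" using not_less_Least[of i "\<lambda>j. \<bar>x\<bar> \<le> 2^j * d"] Suc by (simp add: j_def)
    then have "(2^i * d)\<^sup>2 \<le> \<bar>x\<bar>\<^sup>2" using d by (intro power_mono) auto
    moreover have "((2::real)^i)\<^sup>2 = 4^i"
      by (metis four_x_squared mult_2 numeral_Bit0 power2_eq_square power_mult_distrib)
    then have "(2^i * d)\<^sup>2 = 4^j * d\<^sup>2 / 4"
      by (simp add: Suc power_mult_distrib)
    ultimately have *: "4^j * d\<^sup>2 / 4 \<le> x\<^sup>2" by simp
    have "4^j * d\<^sup>2 / 4 \<le> d\<^sup>2 + x\<^sup>2"
      using add_mono[OF zero_le_power2[of d] *] by simp
    then have "1 / (d\<^sup>2 + x\<^sup>2) \<le> 1 / (4^j * d\<^sup>2 / 4)" using d by (intro frac_le) auto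
    then show ?thesis by simp
  qed
  also have "\<dots> = ?f j" using j x(1) by simp
  also have "\<dots> \<le> (\<Sum>j\<le>J. ?f j)" using jJ d by (intro member_le_sum) auto
  finally show ?thesis .
qed

lemma integral_circ_subinterval:
  fixes g :: "real \<Rightarrow> real"
  assumes g: "integrable circ g" and sub: "{a..b} \<subseteq> {0..2*pi}"
  shows "integrable circ (\<lambda>s. of_bool (s \<in> {a..b}) * g s)"
    and "(LINT s|circ. of_bool (s \<in> {a..b}) * g s) = integral {a..b} g"
proof -
  have 1: "(\<lambda>s. of_bool (s \<in> {a..b}) * g s) = (\<lambda>s. indicator {a..b} s *\<^sub>R g s)"
    by (auto simp: indicator_def)
  show i: "integrable circ (\<lambda>s. of_bool (s \<in> {a..b}) * g s)"
    unfolding 1 using g sub by (intro integrable_mult_indicator) (auto simp: sets_restrict_space_iff)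
  have "(LINT s|circ. of_bool (s \<in> {a..b}) * g s) = integral {0..2*pi} (\<lambda>s. of_bool (s \<in> {a..b}) * g s)"
    by (rule lebesgue_integral_eq_integral[OF i]) auto
  also have "\<dots> = integral {0..2*pi} (\<lambda>s. if s \<in> {a..b} then g s else 0)"
    by (intro integral_cong) auto
  also have "\<dots> = integral {a..b} g"
    using sub by (simp only: Henstock_Kurzweil_Integration.integral_restrict_Int Int_absorb2)
  finally show "(LINT s|circ. of_bool (s \<in> {a..b}) * g s) = integral {a..b} g" .
qed

text \<open>With \<open>d = 1 - r\<close>, the mass of \<open>g\<close> near \<open>t\<close> at
  scale \<open>2^j * d\<close> is a small multiple of that scale, while the weight of the kernel
  there is of order \<open>1 / (4^j * d)\<close>. The products decay like \<open>(1/2)^j\<close>, so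
  their sum is small independently of \<open>r\<close>; the part away from \<open>t\<close> is of
  order \<open>1 - r\<close>.\<close>

lemma poisson_tendsto_zero:
  fixes g :: "real \<Rightarrow> real"
  assumes g: "integrable circ g" "\<And>s. 0 \<le> g s" and t: "0 < t" "t < 2*pi"
    and leb: "\<And>e. 0 < e \<Longrightarrow> \<exists>d>0. \<forall>h. 0 < h \<and> h < d \<longrightarrow> integral {t-h..t+h} g \<le> e * h"
  shows "((\<lambda>r. LINT s|circ. poisson (of_real r * cis t) s * g s) \<longlongrightarrow> 0) (at_left 1)"
proof (rule tendstoI)
  fix e :: real assume e: "0 < e"
  \<comment> \<open>The constant 128: \<open>32 / (4^j * d)\<close> times
    \<open>e/128 * (2^j * d)\<close> is \<open>e/4 * (1/2)^j\<close>, and the geometric sum is at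
    most 2, so the near part costs at most \<open>e/2\<close>.\<close>
  obtain d0 where d0: "d0 > 0" "\<And>h. 0 < h \<Longrightarrow> h < d0 \<Longrightarrow> integral {t-h..t+h} g \<le> (e/128) * h"
    using leb[of "e/128"] e by auto
  \<comment> \<open>Below \<open>d0\<close> for the Lebesgue estimate, at most 1 for
    \<open>poisson_bound_near\<close>, and small enough that the interval around \<open>t\<close>
    stays in \<open>{0..2*pi}\<close>.\<close>
  define \<delta> where "\<delta> = min (d0/2) (min 1 (min t (2*pi - t)))"
  have \<delta>: "0 < \<delta>" "\<delta> < d0" "\<delta> \<le> 1" "\<delta> \<le> t" "t \<le> 2*pi - \<delta>" using d0(1) t by (auto simp: \<delta>_def)
  have \<delta>pi: "\<delta> \<le> pi" using \<delta> pi_gt3 by linarith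
  define C where "C = 2 / (1 - cos \<delta>) * (LINT s|circ. g s)"
  have est: "(LINT s|circ. poisson (of_real r * cis t) s * g s) \<le> e/2 + C * (1 - r)" if r: "1/2 \<le> r" "r < 1" for r
  proof -
    define d where "d = 1 - r"
    have d: "0 < d" using r by (simp add: d_def)
    obtain J where "\<delta> / d < 2^J" using real_arch_pow[of 2 "\<delta>/d"] by auto
    then have J: "\<delta> \<le> 2^J * d" using d by (simp add: field_simps)
    define h where "h j = min (2^j * d) \<delta>" for j :: nat
    have h: "0 < h j" "h j < d0" "h j \<le> 2^j * d" "0 \<le> t - h j" "t + h j \<le> 2*pi" for j
      using d \<delta> by (auto simp: h_def)
    have pw: "poisson (of_real r * cis t) s * g s \<le>
       2 * d / (1 - cos \<delta>) * g s + (\<Sum>j\<le>J. 32 / (4^j * d) * (of_bool (s \<in> {t - h j..t + h j}) * g s))"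
      (is "_ \<le> ?A + ?B") if s: "s \<in> {0..2*pi}" for s
    proof (cases "\<bar>s - t\<bar> \<le> \<delta>")
      case True
      have "poisson (of_real r * cis t) s \<le> 8 * d / (d\<^sup>2 + (s - t)\<^sup>2)"
        unfolding d_def using True \<delta> by (intro poisson_bound_near r) auto
      also have "\<dots> = 8 * d * (1 / (d\<^sup>2 + (s - t)\<^sup>2))" by simp
      also have "\<dots> \<le> 8 * d * (\<Sum>j\<le>J. 4 / (4^j * d\<^sup>2) * of_bool (\<bar>s - t\<bar> \<le> min (2^j * d) \<delta>))"
        using d by (intro mult_left_mono dyadic_bound True J) auto
      also have "\<dots> = (\<Sum>j\<le>J. 32 / (4^j * d) * of_bool (s \<in> {t - h j..t + h j}))"
        unfolding sum_distrib_left
        by (intro sum.cong refl) (auto simp: h_def abs_le_iff power2_eq_square)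
      finally have "poisson (of_real r * cis t) s * g s \<le> (\<Sum>j\<le>J. 32 / (4^j * d) * of_bool (s \<in> {t - h j..t + h j})) * g s"
        by (rule mult_right_mono) (rule g)
      also have "\<dots> = ?B" by (simp add: sum_distrib_right mult.assoc)
      finally show ?thesis using g(2)[of s] d by (smt (verit, best) cos_le_one divide_nonneg_nonneg mult_nonneg_nonneg)
    next
      case False
      have "poisson (of_real r * cis t) s \<le> 2 * d / (1 - cos \<delta>)"
        unfolding d_def using False \<delta> s by (intro poisson_bound_far r \<delta>pi) auto
      then have "poisson (of_real r * cis t) s * g s \<le> ?A"
        by (rule mult_right_mono) (rule g)
      moreover have "0 \<le> ?B" using g d by (intro sum_nonneg) auto
      ultimately show ?thesis by linarith
    qed
    have z: "cmod (of_real r * cis t) < 1" using r by (simp add: norm_mult)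
    have sub: "{t - h j..t + h j} \<subseteq> {0..2*pi}" for j using h[of j] by auto
    have intj: "integrable circ (\<lambda>s. of_bool (s \<in> {t - h j..t + h j}) * g s)"
       "(LINT s|circ. of_bool (s \<in> {t - h j..t + h j}) * g s) \<le> e/128 * (2^j * d)" for j
    proof -
      show "integrable circ (\<lambda>s. of_bool (s \<in> {t - h j..t + h j}) * g s)"
        by (intro integral_circ_subinterval g sub)
      have "(LINT s|circ. of_bool (s \<in> {t - h j..t + h j}) * g s) \<le> e/128 * h j"
        using h d0(2)[of "h j"] by (subst integral_circ_subinterval(2)[OF g(1) sub]) auto
      also have "\<dots> \<le> e/128 * (2^j * d)" using e h by (intro mult_left_mono) auto
      finally show "(LINT s|circ. of_bool (s \<in> {t - h j..t + h j}) * g s) \<le> e/128 * (2^j * d)" .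
    qed
    have "(LINT s|circ. poisson (of_real r * cis t) s * g s) \<le>
       (LINT s|circ. 2 * d / (1 - cos \<delta>) * g s + (\<Sum>j\<le>J. 32 / (4^j * d) * (of_bool (s \<in> {t - h j..t + h j}) * g s)))"
      using pw z g intj by (intro integral_mono poisson_mult_integrable_real Bochner_Integration.integrable_add Bochner_Integration.integrable_sum integrable_mult_right) auto
    also have "\<dots> = 2 * d / (1 - cos \<delta>) * (LINT s|circ. g s) +
       (\<Sum>j\<le>J. 32 / (4^j * d) * (LINT s|circ. of_bool (s \<in> {t - h j..t + h j}) * g s))"
      using g intj by (subst Bochner_Integration.integral_add)
        (auto intro!: Bochner_Integration.integrable_sum integrable_mult_right simp: Bochner_Integration.integral_sum simp del: of_bool_eq_iff)
    also have "\<dots> \<le> C * d + (\<Sum>j\<le>J. 32 / (4^j * d) * (e/128 * (2^j * d)))"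
      using intj d by (intro add_mono sum_mono mult_left_mono) (auto simp: C_def mult_ac)
    also have "(\<Sum>j\<le>J. 32 / (4^j * d) * (e/128 * (2^j * d))) = e/4 * (\<Sum>j\<le>J. (1/2)^j)"
      unfolding sum_distrib_left using d
      by (intro sum.cong refl) (simp add: field_simps flip: power_mult_distrib)
    also have "(\<Sum>j\<le>J. (1/2)^j) \<le> (2::real)"
      using sum_gp0[of "1/2::real" J] by simp
    finally show ?thesis using e by (simp add: d_def algebra_simps)
  qed
  have "((\<lambda>r. e/2 + C * (1 - r)) \<longlongrightarrow> e/2 + C * (1 - 1)) (at_left 1)"
    by (intro tendsto_intros)
  from order_tendstoD(2)[OF this, of e] have "\<forall>\<^sub>F r in at_left 1. e/2 + C * (1 - r) < e"
    using e by simp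
  moreover have "\<forall>\<^sub>F r in at_left (1::real). r \<in> {1/2<..<1}"
    by (rule eventually_at_left_real) simp
  ultimately show "\<forall>\<^sub>F r in at_left 1. dist (LINT s|circ. poisson (of_real r * cis t) s * g s) 0 < e"
  proof eventually_elim
    case (elim r)
    have "0 \<le> (LINT s|circ. poisson (of_real r * cis t) s * g s)"
      using g elim by (intro Bochner_Integration.integral_nonneg) (auto intro!: mult_nonneg_nonneg poisson_nonneg simp: norm_mult)
    then show ?case using est[of r] elim by simp
  qed
qed

text \<open>Fatou's theorem. The kernel is nonnegative with total mass \<open>2*pi\<close>, so the
  error is at most the Poisson mean of \<open>cmod (f s - f t)\<close>, which tends to 0 at Lebesgue
  points.\<close>

theorem poisson_radial_limit:
  fixes f :: "real \<Rightarrow> complex"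
  assumes f: "integrable circ f"
  shows "AE t in circ. ((\<lambda>r. (LINT s|circ. of_real (poisson (of_real r * cis t) s) * f s) / (2*pi)) \<longlongrightarrow> f t) (at_left 1)"
proof -
  define g where "g = (\<lambda>s. if s \<in> {0..2*pi} then f s else 0)"
  have "f absolutely_integrable_on {0..2*pi}"
    using f by (simp add: absolutely_integrable_on_def integrable_restrict_space set_integrable_def)
  then have "g absolutely_integrable_on UNIV"
    unfolding g_def using absolutely_integrable_restrict_UNIV by blast
  then have "g absolutely_integrable_on {a..b}" for a b
    by (rule set_integrable_subset) auto
  then obtain N where N: "negligible N" "\<And>x e. \<lbrakk>x \<notin> N; 0 < e\<rbrakk> \<Longrightarrow>
       \<exists>d>0. \<forall>h. 0 < h \<and> h < d \<longrightarrow> integral {x-h..x+h} (\<lambda>s. norm (g s - g x)) \<le> e * h"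
    using lebesgue_points by metis
  \<comment> \<open>Discarding the two endpoints puts \<open>t\<close> in the open interval and
    avoids a periodic extension of \<open>f\<close>.\<close>
  have "AE t in lebesgue. t \<notin> N \<union> {0, 2*pi}"
    using N(1) by (intro AE_not_in) (auto simp: negligible_iff_null_sets[symmetric])
  then have "AE t in circ. t \<notin> N \<union> {0, 2*pi}"
    by (subst AE_restrict_space_iff) auto
  then show ?thesis
  proof (rule AE_mp, intro AE_I2 impI)
    fix t assume "t \<in> space circ" and tN: "t \<notin> N \<union> {0, 2*pi}"
    then have t: "0 < t" "t < 2*pi" by auto
    define \<psi> where "\<psi> s = cmod (f s - f t)" for s
    have int: "integrable circ \<psi>" unfolding \<psi>_def
      using f integrable_circ_const[of "f t"] by auto
    have lim: "((\<lambda>r. LINT s|circ. poisson (of_real r * cis t) s * \<psi> s) \<longlongrightarrow> 0) (at_left 1)"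
    proof (rule poisson_tendsto_zero[OF int _ t])
      fix e :: real assume e: "0 < e"
      obtain d where d: "d > 0" "\<And>h. 0 < h \<Longrightarrow> h < d \<Longrightarrow> integral {t-h..t+h} (\<lambda>s. norm (g s - g t)) \<le> e * h"
        using N(2)[of t e] tN e by auto
      have "integral {t-h..t+h} \<psi> \<le> e * h" if "0 < h" "h < min d (min t (2*pi - t))" for h
      proof -
        have "integral {t-h..t+h} \<psi> = integral {t-h..t+h} (\<lambda>s. norm (g s - g t))"
          using that t by (intro integral_cong) (auto simp: g_def \<psi>_def)
        then show ?thesis using d(2)[of h] that by simp
      qed
      then show "\<exists>d>0. \<forall>h. 0 < h \<and> h < d \<longrightarrow> integral {t-h..t+h} \<psi> \<le> e * h"
        using d(1) t by (intro exI[of _ "min d (min t (2*pi - t))"]) auto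
    qed (simp add: \<psi>_def)
    have "\<forall>\<^sub>F r in at_left (1::real). r \<in> {0<..<1}"
      by (rule eventually_at_left_real) simp
    then have "\<forall>\<^sub>F r in at_left 1. cmod ((LINT s|circ. of_real (poisson (of_real r * cis t) s) * f s) / (2*pi) - f t) \<le> (LINT s|circ. poisson (of_real r * cis t) s * \<psi> s) / (2*pi)"
    proof eventually_elim
      case (elim r)
      define z where "z = of_real r * cis t"
      have z: "cmod z < 1" using elim by (simp add: z_def norm_mult)
      have i1: "integrable circ (\<lambda>s. of_real (poisson z s) * f s)"
        and i2: "integrable circ (\<lambda>s. of_real (poisson z s) * f t)"
        using z f integrable_circ_const[of "f t"] by (intro poisson_mult_integrable; simp)+
      have "(LINT s|circ. of_real (poisson z s) * f t) = 2*pi * f t"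
        using integral_poisson[OF z] integral_complex_of_real[of circ "poisson z"] by simp
      then have "(LINT s|circ. of_real (poisson z s) * f s) / (2*pi) - f t =
         ((LINT s|circ. of_real (poisson z s) * f s) - (LINT s|circ. of_real (poisson z s) * f t)) / (2*pi)"
        by (simp add: field_simps)
      also have "\<dots> = (LINT s|circ. of_real (poisson z s) * (f s - f t)) / (2*pi)"
        using i1 i2 by (simp add: right_diff_distrib)
      also have "cmod \<dots> \<le> (LINT s|circ. cmod (of_real (poisson z s) * (f s - f t))) / (2*pi)"
        by (simp add: norm_divide divide_right_mono integral_norm_bound)
      also have "(LINT s|circ. cmod (of_real (poisson z s) * (f s - f t))) = (LINT s|circ. poisson z s * \<psi> s)"
        using poisson_nonneg[OF z] by (simp add: norm_mult \<psi>_def)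
      finally show ?case by (simp add: z_def)
    qed
    moreover have "((\<lambda>r. (LINT s|circ. poisson (of_real r * cis t) s * \<psi> s) / (2*pi)) \<longlongrightarrow> 0) (at_left 1)"
      using tendsto_divide[OF lim tendsto_const[of "2*pi"]] by simp
    ultimately have "((\<lambda>r. (LINT s|circ. of_real (poisson (of_real r * cis t) s) * f s) / (2*pi) - f t) \<longlongrightarrow> 0) (at_left 1)"
      by (rule Lim_null_comparison)
    then show "((\<lambda>r. (LINT s|circ. of_real (poisson (of_real r * cis t) s) * f s) / (2*pi)) \<longlongrightarrow> f t) (at_left 1)"
      by (rule LIM_zero_cancel)
  qed
qed

corollary poisson_radial_limit_real:
  fixes f :: "real \<Rightarrow> real"
  assumes f: "integrable circ f"
  shows "AE t in circ. ((\<lambda>r. (LINT s|circ. poisson (of_real r * cis t) s * f s) / (2*pi)) \<longlongrightarrow> f t) (at_left 1)"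
proof -
  have "integrable circ (\<lambda>t. complex_of_real (f t))" using f by simp
  from poisson_radial_limit[OF this] show ?thesis
  proof (rule AE_mp, intro AE_I2 impI)
    fix t
    have *: "(LINT s|circ. complex_of_real (poisson z s) * complex_of_real (f s)) / complex_of_real (2*pi) =
       complex_of_real ((LINT s|circ. poisson z s * f s) / (2*pi))" for z
      by (simp flip: integral_complex_of_real of_real_mult)
    assume "((\<lambda>r. (LINT s|circ. complex_of_real (poisson (of_real r * cis t) s) * complex_of_real (f s)) / complex_of_real (2*pi)) \<longlongrightarrow> complex_of_real (f t)) (at_left 1)"
    then show "((\<lambda>r. (LINT s|circ. poisson (of_real r * cis t) s * f s) / (2*pi)) \<longlongrightarrow> f t) (at_left 1)"
      unfolding * tendsto_of_real_iff .
  qed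
qed

section \<open>Boundary values of bounded holomorphic functions\<close>

definition taylor_coeff :: "(complex \<Rightarrow> complex) \<Rightarrow> nat \<Rightarrow> complex" where
  "taylor_coeff f k = (deriv ^^ k) f 0 / fact k"

lemma taylor_sums:
  assumes "f holomorphic_on ball 0 1" "cmod z < 1"
  shows "(\<lambda>k. taylor_coeff f k * z^k) sums f z"
  using holomorphic_power_series[OF assms(1), of z] assms(2) by (simp add: taylor_coeff_def)

lemma taylor_summable_norm:
  assumes f: "f holomorphic_on ball 0 1" and z: "cmod z < 1"
  shows "summable (\<lambda>k. cmod (taylor_coeff f k * z^k))"
proof -
  obtain r where r: "cmod z < r" "r < 1" using z dense by blast
  then have "cmod (of_real r) < 1" using norm_ge_zero[of z] by (simp del: norm_ge_zero)
  then have "summable (\<lambda>k. taylor_coeff f k * of_real r ^ k)"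
    using taylor_sums[OF f] sums_summable by blast
  moreover have "cmod z < cmod (of_real r)" using r by simp
  ultimately show ?thesis by (rule powser_insidea)
qed

lemma taylor_circle_sums:
  assumes f: "f holomorphic_on ball 0 1" and r: "0 \<le> r" "r < 1"
  shows "summable (\<lambda>k. cmod (taylor_coeff f k * of_real r^k))"
    and "(\<lambda>k. (taylor_coeff f k * of_real r^k) * cis (real k * t)) sums f (of_real r * cis t)"
proof -
  show "summable (\<lambda>k. cmod (taylor_coeff f k * of_real r^k))"
    using r by (intro taylor_summable_norm f) simp
  have "(\<lambda>k. taylor_coeff f k * (of_real r * cis t)^k) sums f (of_real r * cis t)"
    using r by (intro taylor_sums f) (simp add: norm_mult)
  then show "(\<lambda>k. (taylor_coeff f k * of_real r^k) * cis (real k * t)) sums f (of_real r * cis t)"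
    by (simp add: power_mult_distrib Complex.DeMoivre mult.assoc)
qed

lemma circle_measurable:
  assumes f: "f holomorphic_on ball 0 1" and r: "0 \<le> r" "r < 1"
  shows "(\<lambda>t. f (of_real r * cis t)) \<in> borel_measurable circ"
proof (rule continuous_measurable_circ)
  have "continuous_on (ball 0 1) f" using f holomorphic_on_imp_continuous_on by blast
  then show "continuous_on UNIV (\<lambda>t. f (of_real r * cis t))"
    by (rule continuous_on_compose2) (use r in \<open>auto intro!: continuous_intros simp: norm_mult\<close>)
qed

lemma circle_integrable:
  assumes f: "f holomorphic_on ball 0 1" and r: "0 \<le> r" "r < 1"
  shows "integrable circ (\<lambda>t. f (of_real r * cis t))"
proof -
  have "cmod (f (of_real r * cis t)) \<le> (\<Sum>k. cmod (taylor_coeff f k * of_real r^k))" for t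
  proof -
    note s = taylor_circle_sums[OF f r]
    have "summable (\<lambda>k. cmod ((taylor_coeff f k * of_real r^k) * cis (real k * t)))"
      using s(1) by (simp add: norm_mult)
    from summable_norm[OF this] show ?thesis
      using sums_unique[OF s(2)[of t]] by (simp add: norm_mult)
  qed
  then show ?thesis by (intro integrable_circ_bounded circle_measurable f r)
qed

lemma cis_measurable_neg [measurable]: "(\<lambda>t. cis (- (a * t))) \<in> borel_measurable circ"
  using measurable_cis_circ[of "- a"] by simp

text \<open>Orthogonality of the exponentials isolates single Taylor coefficients. The second
  equation, the absence of negative frequencies, is where holomorphy enters the Poisson
  formula.\<close>

lemma circle_coeff:
  assumes f: "f holomorphic_on ball 0 1" and r: "0 \<le> r" "r < 1"
  shows "(LINT t|circ. f (of_real r * cis t) * cis (- (real n * t))) = 2*pi * (taylor_coeff f n * of_real r^n)"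
    and "(LINT t|circ. f (of_real r * cis t) * cis (real n * t)) = (if n = 0 then 2*pi * taylor_coeff f 0 else 0)"
proof -
  note s = taylor_circle_sums[OF f r]
  have i: "integrable circ (\<lambda>t. cis (a * t))" for a
    by (rule integrable_circ_bounded[where B=1]) auto
  have i': "integrable circ (\<lambda>t. cis (- (a * t)))" for a
    using i[of "- a"] by simp
  have "(\<lambda>k. taylor_coeff f k * of_real r^k * (LINT t|circ. cis (real k * t) * cis (- (real n * t)))) sums
      (LINT t|circ. f (of_real r * cis t) * cis (- (real n * t)))"
    by (rule sums_integral_circ[where B=1, OF s(1) _ _ i' s(2)]) auto
  moreover have "(\<lambda>k. taylor_coeff f k * of_real r^k * (LINT t|circ. cis (real k * t) * cis (- (real n * t)))) =
     (\<lambda>k. if k = n then 2*pi * (taylor_coeff f k * of_real r^k) else 0)"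
    unfolding integral_cis_circ_nat fun_eq_iff by simp
  ultimately have "(\<lambda>k. if k = n then 2*pi * (taylor_coeff f k * of_real r^k) else 0) sums
      (LINT t|circ. f (of_real r * cis t) * cis (- (real n * t)))" by simp
  from sums_unique2[OF this sums_single]
  show "(LINT t|circ. f (of_real r * cis t) * cis (- (real n * t))) = 2*pi * (taylor_coeff f n * of_real r^n)" .
  have "(\<lambda>k. taylor_coeff f k * of_real r^k * (LINT t|circ. cis (real k * t) * cis (real n * t))) sums
      (LINT t|circ. f (of_real r * cis t) * cis (real n * t))"
    by (rule sums_integral_circ[where B=1, OF s(1) _ _ i s(2)]) auto
  moreover have "(\<lambda>k. taylor_coeff f k * of_real r^k * (LINT t|circ. cis (real k * t) * cis (real n * t))) =
     (\<lambda>k. if k = 0 then (if n = 0 then 2*pi * taylor_coeff f 0 else 0) else 0)"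
    unfolding integral_cis_circ_nat_add fun_eq_iff by simp
  ultimately have "(\<lambda>k. if k = 0 then (if n = 0 then 2*pi * taylor_coeff f 0 else 0) else 0) sums
      (LINT t|circ. f (of_real r * cis t) * cis (real n * t))" by simp
  from sums_unique2[OF this sums_single]
  show "(LINT t|circ. f (of_real r * cis t) * cis (real n * t)) = (if n = 0 then 2*pi * taylor_coeff f 0 else 0)" .
qed

text \<open>The Herglotz integral of the circle values is
  \<open>2*pi * (2 * f (r * z) - a 0)\<close>, with \<open>a 0\<close> the constant coefficient;
  that of the conjugated values keeps only \<open>2*pi * cnj (a 0)\<close>. In
  \<open>integral_poisson_complex\<close> the constants cancel.\<close>

lemma poisson_formula:
  fixes f :: "complex \<Rightarrow> complex"
  assumes f: "f holomorphic_on ball 0 1" and r: "0 \<le> r" "r < 1" and z: "cmod z < 1"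
  shows "(LINT t|circ. of_real (poisson z t) * f (of_real r * cis t)) = 2*pi * f (of_real r * z)"
proof -
  define a where "a = taylor_coeff f"
  define g where "g t = f (of_real r * cis t)" for t
  have g: "integrable circ g" unfolding g_def using circle_integrable[OF f r] by simp
  have 1: "(LINT t|circ. cis (- (real k * t)) * g t) = 2*pi * (a k * of_real r^k)" for k
    using circle_coeff(1)[OF f r, of k] by (simp add: a_def g_def mult.commute)
  have "(LINT t|circ. cis (- (real k * t)) * cnj (g t)) = cnj (LINT t|circ. g t * cis (real k * t))" for k
    by (subst Bochner_Integration.integral_cnj[symmetric]) (simp add: mult.commute cis_cnj)
  then have 2: "(LINT t|circ. cis (- (real k * t)) * cnj (g t)) = (if k = 0 then 2*pi * cnj (a 0) else 0)" for k
    using circle_coeff(2)[OF f r, of k] by (simp add: a_def g_def)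
  have "cmod (of_real r * z) < 1" using r z mult_strict_mono'[of r 1 "cmod z" 1] by (simp add: norm_mult)
  from taylor_sums[OF f this] have "(\<lambda>k. 2*pi * 2 * (a k * (of_real r * z)^k) - (if k = 0 then 2*pi * a 0 else 0)) sums (2*pi*2 * f (of_real r * z) - 2*pi * a 0)"
    unfolding a_def[symmetric] using sums_single[of 0 "\<lambda>_. 2*pi * a 0"] by (intro sums_diff sums_mult)
  moreover have "(\<lambda>k. 2*pi * 2 * (a k * (of_real r * z)^k) - (if k = 0 then 2*pi * a 0 else 0)) =
     (\<lambda>k. ((if k = 0 then 1 else 2) * z^k) * (LINT t|circ. cis (- (real k * t)) * g t))"
    unfolding 1 by (auto simp: fun_eq_iff power_mult_distrib)
  ultimately have A: "(LINT t|circ. herglotz z t * g t) = 2*pi*2 * f (of_real r * z) - 2*pi * a 0"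
    using sums_unique2[OF herglotz_integral_sums[OF z g]] by simp
  have "(\<lambda>k. ((if k = 0 then 1 else 2) * z^k) * (LINT t|circ. cis (- (real k * t)) * cnj (g t))) =
     (\<lambda>k. if k = 0 then 2*pi * cnj (a 0) else 0)"
    unfolding 2 by (auto simp: fun_eq_iff)
  then have "(\<lambda>k. if k = 0 then 2*pi * cnj (a 0) else 0) sums (LINT t|circ. herglotz z t * cnj (g t))"
    using herglotz_integral_sums[OF z, of "\<lambda>t. cnj (g t)"] g by simp
  from sums_unique2[OF this sums_single] have B: "(LINT t|circ. herglotz z t * cnj (g t)) = 2*pi * cnj (a 0)" .
  show ?thesis using integral_poisson_complex[OF z g] A B by (simp add: g_def algebra_simps)
qed

text \<open>Two radii, because the squared L2 distance of two dilates contains a mixed term; all its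
  terms thus become values of one power series.\<close>

lemma parseval:
  assumes f: "f holomorphic_on ball 0 1" and r: "0 \<le> r" "r < 1" and s: "0 \<le> s" "s < 1"
  shows "(\<lambda>k. 2*pi * ((cmod (taylor_coeff f k))\<^sup>2 * (r * s)^k)) sums
     Re (LINT t|circ. cnj (f (of_real s * cis t)) * f (of_real r * cis t))"
proof -
  define a where "a = taylor_coeff f"
  have "(\<lambda>k. cnj (a k * of_real s^k) * (LINT t|circ. cis (- (real k * t)) * f (of_real r * cis t))) sums
     (LINT t|circ. cnj (f (of_real s * cis t)) * f (of_real r * cis t))"
  proof (rule sums_integral_circ[where B=1])
    show "summable (\<lambda>k. cmod (cnj (a k * of_real s^k)))"
      unfolding complex_mod_cnj a_def by (rule taylor_circle_sums(1)[OF f s])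
    show "(\<lambda>k. cnj (a k * of_real s^k) * cis (- (real k * t))) sums cnj (f (of_real s * cis t))" for t
      using sums_cnj[THEN iffD2, OF taylor_circle_sums(2)[OF f s, of t]] by (simp add: a_def cis_cnj)
  qed (auto intro: circle_integrable f r)
  moreover have "cnj (a k * of_real s^k) * (LINT t|circ. cis (- (real k * t)) * f (of_real r * cis t)) =
     complex_of_real (2*pi * ((cmod (a k))\<^sup>2 * (r * s)^k))" for k
  proof -
    have "(LINT t|circ. cis (- (real k * t)) * f (of_real r * cis t)) = 2*pi * (a k * of_real r^k)"
      using circle_coeff(1)[OF f r, of k] by (simp add: a_def mult.commute)
    moreover have "complex_of_real ((cmod (a k))\<^sup>2) = a k * cnj (a k)" by (rule complex_norm_square)
    ultimately show ?thesis by (simp add: power_mult_distrib)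
  qed
  ultimately have "(\<lambda>k. complex_of_real (2*pi * ((cmod (a k))\<^sup>2 * (r * s)^k))) sums
     (LINT t|circ. cnj (f (of_real s * cis t)) * f (of_real r * cis t))" by simp
  then show ?thesis unfolding a_def using sums_Re by fastforce
qed

text \<open>By monotone convergence the sum of the norms has a finite integral, so it is finite
  almost everywhere.\<close>

lemma AE_summable_norm:
  fixes f :: "nat \<Rightarrow> 'a \<Rightarrow> 'b::{banach, second_countable_topology}"
  assumes f: "\<And>n. integrable M (f n)" and s: "summable (\<lambda>n. LINT t|M. norm (f n t))"
  shows "AE t in M. summable (\<lambda>n. norm (f n t))"
proof -
  have [measurable]: "f n \<in> borel_measurable M" for n using f by auto
  have "(\<integral>\<^sup>+ t. (\<Sum>n. ennreal (norm (f n t))) \<partial>M) = (\<Sum>n. \<integral>\<^sup>+ t. ennreal (norm (f n t)) \<partial>M)"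
    by (rule nn_integral_suminf) auto
  also have "\<dots> = (\<Sum>n. ennreal (LINT t|M. norm (f n t)))"
    using f by (intro suminf_cong nn_integral_eq_integral) auto
  also have "\<dots> < \<infinity>"
    using s by (subst suminf_ennreal2) auto
  finally have "(\<integral>\<^sup>+ t. (\<Sum>n. ennreal (norm (f n t))) \<partial>M) \<noteq> \<infinity>" by simp
  then have "AE t in M. (\<Sum>n. ennreal (norm (f n t))) \<noteq> \<infinity>"
    by (intro nn_integral_PInf_AE) auto
  then show ?thesis
    by eventually_elim (auto intro: summable_suminf_not_top)
qed

text \<open>
  With \<open>N\<close> bounded and increasing, the identity shows that the restrictions of \<open>f\<close> to the circles of
  radius \<open>r\<close> are Cauchy in \<open>L\<^sup>2\<close> as \<open>r\<close> tends to \<open>1\<close>.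
\<close>

lemma L2_difference:
  assumes f: "f holomorphic_on ball 0 1" and C: "\<And>z. cmod z < 1 \<Longrightarrow> cmod (f z) \<le> C"
  obtains N :: "real \<Rightarrow> real" where
    "\<And>p q. \<lbrakk>0 \<le> p; p \<le> q; q < 1\<rbrakk> \<Longrightarrow> N p \<le> N q" "\<And>q. \<lbrakk>0 \<le> q; q < 1\<rbrakk> \<Longrightarrow> N q \<le> 2*pi*C\<^sup>2"
    "\<And>r s. \<lbrakk>0 \<le> r; r < 1; 0 \<le> s; s < 1\<rbrakk> \<Longrightarrow>
       (LINT t|circ. (cmod (f (of_real r * cis t) - f (of_real s * cis t)))\<^sup>2) = N (r\<^sup>2) + N (s\<^sup>2) - 2 * N (r * s)"
proof
  define a where "a = taylor_coeff f"
  \<comment> \<open>The Parseval series in the product of the radii. Its nonnegative coefficients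
    make it increasing, and its value at \<open>q\<close> is the squared L2 norm on the circle of
    radius \<open>sqrt q\<close>.\<close>
  define N where "N q = (\<Sum>k. 2*pi * ((cmod (a k))\<^sup>2 * q^k))" for q :: real
  have N: "N (r * s) = Re (LINT t|circ. cnj (f (of_real s * cis t)) * f (of_real r * cis t))"
      "summable (\<lambda>k. 2*pi * ((cmod (a k))\<^sup>2 * (r * s)^k))"
    if "0 \<le> r" "r < 1" "0 \<le> s" "s < 1" for r s
    using parseval[OF f that] unfolding N_def a_def by (auto simp: sums_iff)
  have sq: "0 \<le> sqrt q" "sqrt q < 1" "q = sqrt q * sqrt q" if "0 \<le> q" "q < 1" for q
    using that by auto
  have int2: "integrable circ (\<lambda>t. cnj (f (of_real s * cis t)) * f (of_real r * cis t))"
    if "0 \<le> r" "r < 1" "0 \<le> s" "s < 1" for r s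
  proof (rule integrable_circ_mult_bounded[where B=C])
    show "cmod (cnj (f (of_real s * cis t))) \<le> C" for t
      using that by (simp add: C norm_mult)
    show "(\<lambda>t. cnj (f (of_real s * cis t))) \<in> borel_measurable circ"
      by (rule measurable_compose[OF circle_measurable[OF f that(3,4)]])
        (intro borel_measurable_continuous_onI continuous_intros)
  qed (rule circle_integrable[OF f that(1,2)])
  show "N p \<le> N q" if "0 \<le> p" "p \<le> q" "q < 1" for p q
    unfolding N_def
  proof (rule suminf_le)
    show "2*pi * ((cmod (a n))\<^sup>2 * p^n) \<le> 2*pi * ((cmod (a n))\<^sup>2 * q^n)" for n
      using that by (intro mult_left_mono power_mono) auto
    have "p < 1" "0 \<le> q" using that by auto
    then show "summable (\<lambda>k. 2*pi * ((cmod (a k))\<^sup>2 * p^k))" "summable (\<lambda>k. 2*pi * ((cmod (a k))\<^sup>2 * q^k))"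
      using N(2)[of "sqrt p" "sqrt p"] N(2)[of "sqrt q" "sqrt q"] that sq[of p] sq[of q] by simp_all
  qed
  show "N q \<le> 2*pi*C\<^sup>2" if q: "0 \<le> q" "q < 1" for q
  proof -
    note sq = sq[OF q]
    have "N q = Re (LINT t|circ. cnj (f (of_real (sqrt q) * cis t)) * f (of_real (sqrt q) * cis t))"
      using N(1)[OF sq(1,2) sq(1,2)] sq(3) by simp
    also have "\<dots> = (LINT t|circ. Re (cnj (f (of_real (sqrt q) * cis t)) * f (of_real (sqrt q) * cis t)))"
      by (rule integral_Re[symmetric]) (rule int2[OF sq(1,2) sq(1,2)])
    also have "\<dots> \<le> (LINT t|circ. C\<^sup>2)"
    proof (rule integral_mono)
      fix t
      have c: "cmod (f (of_real (sqrt q) * cis t)) \<le> C" using sq by (intro C) (simp add: norm_mult)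
      have "Re (cnj (f (of_real (sqrt q) * cis t)) * f (of_real (sqrt q) * cis t)) = (cmod (f (of_real (sqrt q) * cis t)))\<^sup>2"
        unfolding cmod_power2 by (simp add: power2_eq_square)
      also have "\<dots> \<le> C\<^sup>2" using c by (intro power_mono) auto
      finally show "Re (cnj (f (of_real (sqrt q) * cis t)) * f (of_real (sqrt q) * cis t)) \<le> C\<^sup>2" .
    qed (intro integrable_Re int2 sq integrable_circ_const)+
    also have "\<dots> = 2*pi*C\<^sup>2" by (simp only: integral_circ_const real_scaleR_def)
    finally show ?thesis .
  qed
  show "(LINT t|circ. (cmod (f (of_real r * cis t) - f (of_real s * cis t)))\<^sup>2) = N (r\<^sup>2) + N (s\<^sup>2) - 2 * N (r * s)"
    if rs: "0 \<le> r" "r < 1" "0 \<le> s" "s < 1" for r s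
  proof -
    let ?F = "\<lambda>r s t. cnj (f (of_real s * cis t)) * f (of_real r * cis t)"
    have "(cmod (f (of_real r * cis t) - f (of_real s * cis t)))\<^sup>2 = Re (?F r r t) + Re (?F s s t) - 2 * Re (?F r s t)" for t
      unfolding cmod_power2 by (simp add: power2_eq_square algebra_simps)
    then have "(LINT t|circ. (cmod (f (of_real r * cis t) - f (of_real s * cis t)))\<^sup>2) =
      (LINT t|circ. Re (?F r r t) + Re (?F s s t) - 2 * Re (?F r s t))" by presburger
    also have "\<dots> = (LINT t|circ. Re (?F r r t)) + (LINT t|circ. Re (?F s s t)) - 2 * (LINT t|circ. Re (?F r s t))"
      using integrable_Re[OF int2[of r r]] integrable_Re[OF int2[of s s]] integrable_Re[OF int2[of r s]] rs
      by (simp del: times_complex.sel)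
    also have "\<dots> = N (r*r) + N (s * s) - 2 * N (r * s)"
      using N(1)[of r r] N(1)[of s s] N(1)[of r s] int2[of r r] int2[of s s] int2[of r s] rs
      by (simp only: integral_Re)
    finally show ?thesis by (simp add: power2_eq_square)
  qed
qed

text \<open>A Riesz-Fischer argument: the squared L2 norms increase to a supremum \<open>L\<close>,
  so radii can be chosen along which consecutive differences have summable L1 norms, and these
  differences are then summable almost everywhere.\<close>

lemma subsequence_boundary_limit:
  assumes f: "f holomorphic_on ball 0 1" and C: "\<And>z. cmod z < 1 \<Longrightarrow> cmod (f z) \<le> C"
  obtains r :: "nat \<Rightarrow> real" where "\<And>n. 0 \<le> r n" "\<And>n. r n < 1" "r \<longlonglongrightarrow> 1"
    "AE t in circ. convergent (\<lambda>n. f (of_real (r n) * cis t))"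
proof -
  obtain N where Nmono: "\<And>p q. \<lbrakk>0 \<le> p; p \<le> q; q < 1\<rbrakk> \<Longrightarrow> N p \<le> N q"
    and Nbd: "\<And>q. \<lbrakk>0 \<le> q; q < 1\<rbrakk> \<Longrightarrow> N q \<le> 2*pi*C\<^sup>2"
    and Neq: "\<And>r s. \<lbrakk>0 \<le> r; r < 1; 0 \<le> s; s < 1\<rbrakk> \<Longrightarrow>
       (LINT t|circ. (cmod (f (of_real r * cis t) - f (of_real s * cis t)))\<^sup>2) = N (r\<^sup>2) + N (s\<^sup>2) - 2 * N (r * s)"
    using L2_difference[OF f C] by blast
  define L where "L = (SUP q\<in>{0..<1}. N q)"
  have bdd: "bdd_above (N ` {0..<1})" using Nbd by (auto intro!: bdd_aboveI)
  have NL: "N q \<le> L" if "0 \<le> q" "q < 1" for q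
    unfolding L_def using that bdd by (intro cSUP_upper) auto
  have ex: "\<exists>r. 0 \<le> r \<and> r < 1 \<and> 1 - 1 / real (Suc n) \<le> r \<and> L - (1/4)^n \<le> N (r\<^sup>2)" for n
  proof -
    have "L - (1/4)^n < L" by simp
    then obtain q where q: "0 \<le> q" "q < 1" "L - (1/4)^n < N q"
      unfolding L_def using less_cSUP_iff[OF _ bdd, of "L - (1/4)^n"] by (auto simp: L_def)
    \<comment> \<open>The second argument of \<open>max\<close> forces the radii towards 1;
      enlarging a radius only increases \<open>N\<close>.\<close>
    define r where "r = max (sqrt q) (1 - 1 / real (Suc n))"
    have r: "0 \<le> r" "r < 1" "1 - 1 / real (Suc n) \<le> r" "sqrt q \<le> r" using q by (auto simp: r_def le_max_iff_disj)
    have "q = (sqrt q)\<^sup>2" using q by simp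
    also have "\<dots> \<le> r\<^sup>2" using r(4) q by (intro power_mono) auto
    finally have "N q \<le> N (r\<^sup>2)" using q r by (intro Nmono) (auto simp: power_less_one_iff)
    then show ?thesis using r q by (intro exI[of _ r]) auto
  qed
  have "\<exists>r. \<forall>n. 0 \<le> r n \<and> r n < 1 \<and> 1 - 1 / real (Suc n) \<le> r n \<and> L - (1/4)^n \<le> N ((r n)\<^sup>2)"
    by (intro choice allI ex)
  then obtain r where r: "\<And>n. 0 \<le> r n" "\<And>n. r n < 1" "\<And>n. 1 - 1 / real (Suc n) \<le> r n" "\<And>n. L - (1/4)^n \<le> N ((r n)\<^sup>2)"
    by blast
  have lim: "r \<longlonglongrightarrow> 1"
  proof (rule tendsto_sandwich)
    show "(\<lambda>n. 1 - 1 / real (Suc n)) \<longlonglongrightarrow> 1"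
      using tendsto_diff[OF tendsto_const[of 1] LIMSEQ_inverse_real_of_nat] by (simp add: inverse_eq_divide)
    show "\<forall>\<^sub>F n in sequentially. 1 - 1 / real (Suc n) \<le> r n" "\<forall>\<^sub>F n in sequentially. r n \<le> 1"
      using r by (auto intro!: always_eventually less_imp_le)
  qed auto
  define g where "g n t = f (of_real (r (Suc n)) * cis t) - f (of_real (r n) * cis t)" for n t
  have gi: "integrable circ (g n)" for n
    unfolding g_def using r by (intro Bochner_Integration.integrable_diff circle_integrable f)
  have g2: "(LINT t|circ. (cmod (g n t))\<^sup>2) \<le> 2 * (1/4)^n" for n
  proof -
    let ?m = "min (r n) (r (Suc n))"
    have q1: "(r n)\<^sup>2 < 1" "(r (Suc n))\<^sup>2 < 1" "r (Suc n) * r n < 1"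
      using r(1,2) mult_strict_mono'[of "r (Suc n)" 1 "r n" 1] by (auto simp: power_less_one_iff)
    have e: "L - (1/4::real)^n \<le> L - (1/4)^Suc n" by simp
    \<comment> \<open>The radii need not be monotone. Comparison with the smaller one bounds the
      mixed term below by \<open>L - (1/4)^n\<close>, so the squared distance is at most
      \<open>L + L - 2 * (L - (1/4)^n)\<close>.\<close>
    have mm: "?m\<^sup>2 \<le> r (Suc n) * r n" using r(1) by (auto simp: min_def power2_eq_square mult_mono)
    then have "N (?m\<^sup>2) \<le> N (r (Suc n) * r n)" using q1 by (intro Nmono) auto
    moreover have "L - (1/4)^n \<le> N (?m\<^sup>2)" using r(4)[of n] order_trans[OF e r(4)[of "Suc n"]] unfolding min_def by presburger
    moreover have "N ((r n)\<^sup>2) \<le> L" "N ((r (Suc n))\<^sup>2) \<le> L" using q1 by (auto intro!: NL)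
    ultimately show ?thesis using Neq[of "r (Suc n)" "r n"] r unfolding g_def by auto
  qed
  have gb: "cmod (g n t) \<le> 2 * C" for n t
    unfolding g_def using r
    by (intro order_trans[OF norm_triangle_ineq4] order_trans[OF add_mono[OF C C]]) (auto simp: norm_mult)
  have g2i: "integrable circ (\<lambda>t. (cmod (g n t))\<^sup>2)" for n
  proof (rule integrable_circ_bounded[where B="(2*C)\<^sup>2"])
    show "norm ((cmod (g n t))\<^sup>2) \<le> (2*C)\<^sup>2" for t using power_mono[OF gb[of n t], of 2] by simp
    have "g n \<in> borel_measurable circ" using gi by auto
    then show "(\<lambda>t. (cmod (g n t))\<^sup>2) \<in> borel_measurable circ" by measurable
  qed
  have g1: "(LINT t|circ. cmod (g n t)) \<le> (pi + 1) * (1/2)^n" for n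
  proof -
    \<comment> \<open>Arithmetic-geometric mean with weight \<open>2^n\<close>: it passes from L2 to
      L1 and balances both terms, as \<open>2^n * (1/4)^n = (1/2)^n\<close>.\<close>
    have "cmod (g n t) \<le> ((1/2)^n + 2^n * (cmod (g n t))\<^sup>2) / 2" for t
    proof -
      have 1: "(1/2)^n * 2^n = (1::real)" unfolding power_mult_distrib[symmetric] by simp
      have "(A - c)\<^sup>2 * B = A * (A * B) + B * c\<^sup>2 - 2 * c * (A * B)" for A B c :: real
        by (simp add: power2_eq_square algebra_simps)
      from this[of "(1/2)^n" "cmod (g n t)" "2^n"] have "((1/2)^n - cmod (g n t))\<^sup>2 * 2^n = (1/2)^n + 2^n * (cmod (g n t))\<^sup>2 - 2 * cmod (g n t)"
        unfolding 1 by simp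
      moreover have "0 \<le> ((1/2)^n - cmod (g n t))\<^sup>2 * 2^n" by simp
      ultimately have "0 \<le> (1/2)^n + 2^n * (cmod (g n t))\<^sup>2 - 2 * cmod (g n t)" by simp
      then show ?thesis by simp
    qed
    then have "(LINT t|circ. cmod (g n t)) \<le> (LINT t|circ. ((1/2)^n + 2^n * (cmod (g n t))\<^sup>2) / 2)"
      using gi g2i integrable_circ_const by (intro integral_mono) auto
    also have "\<dots> = ((2*pi) * (1/2)^n + 2^n * (LINT t|circ. (cmod (g n t))\<^sup>2)) / 2"
      using g2i integrable_circ_const by (simp add: measure_circ)
    also have "\<dots> \<le> ((2*pi) * (1/2)^n + 2^n * (2 * (1/4)^n)) / 2"
      using g2 by (intro divide_right_mono add_left_mono mult_left_mono) auto
    also have "2^n * (2 * (1/4)^n) = 2 * (1/2::real)^n"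
    proof -
      have "2^n * (1/4)^n = (2 * (1/4) :: real)^n" by (rule power_mult_distrib[symmetric])
      then show ?thesis by simp
    qed
    finally show ?thesis by (simp add: algebra_simps)
  qed
  have "AE t in circ. summable (\<lambda>n. cmod (g n t))"
  proof (rule AE_summable_norm[OF gi])
    have "summable (\<lambda>n. (pi + 1) * (1/2::real)^n)" by (intro summable_mult summable_geometric) auto
    then show "summable (\<lambda>n. LINT t|circ. cmod (g n t))"
    proof (rule summable_comparison_test')
      show "norm (LINT t|circ. cmod (g n t)) \<le> (pi + 1) * (1/2)^n" for n
      proof -
        have "0 \<le> (LINT t|circ. cmod (g n t))" by (rule Bochner_Integration.integral_nonneg) simp
        then show ?thesis unfolding real_norm_def using g1[of n] by linarith
      qed
    qed
  qed
  then have "AE t in circ. convergent (\<lambda>n. f (of_real (r n) * cis t))"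
  proof eventually_elim
    case (elim t)
    then have "(\<lambda>n. \<Sum>i<n. g i t) \<longlonglongrightarrow> (\<Sum>i. g i t)"
      by (rule summable_LIMSEQ[OF summable_norm_cancel])
    moreover have "(\<Sum>i<n. g i t) = f (of_real (r n) * cis t) - f (of_real (r 0) * cis t)" for n
      unfolding g_def by (rule sum_lessThan_telescope)
    ultimately have "(\<lambda>n. f (of_real (r n) * cis t) - f (of_real (r 0) * cis t)) \<longlonglongrightarrow> (\<Sum>i. g i t)"
      by simp
    from tendsto_add[OF this tendsto_const[of "f (of_real (r 0) * cis t)"]] show ?case
      unfolding diff_add_cancel by (rule convergentI)
  qed
  from that[OF r(1,2) lim this] show ?thesis by simp
qed

text \<open>The Poisson formula for the dilates \<open>f (r n * z)\<close> passes to the limit by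
  dominated convergence. Once \<open>f\<close> is the Poisson integral of \<open>\<phi>\<close>,
  Fatou's theorem upgrades the sequential limit to a radial one.\<close>

theorem bounded_holomorphic_boundary:
  assumes f: "f holomorphic_on ball 0 1" and C: "\<And>z. cmod z < 1 \<Longrightarrow> cmod (f z) \<le> C"
  obtains \<phi> :: "real \<Rightarrow> complex" where "integrable circ \<phi>"
    "\<And>z. cmod z < 1 \<Longrightarrow> f z = (LINT t|circ. of_real (poisson z t) * \<phi> t) / (2*pi)"
    "AE t in circ. ((\<lambda>r. f (of_real r * cis t)) \<longlongrightarrow> \<phi> t) (at_left 1)"
proof -
  obtain r where r: "\<And>n. 0 \<le> r n" "\<And>n. r n < 1" "r \<longlonglongrightarrow> 1"
    and conv: "AE t in circ. convergent (\<lambda>n. f (of_real (r n) * cis t))"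
    using subsequence_boundary_limit[OF f C] by blast
  define \<phi> where "\<phi> t = lim (\<lambda>n. f (of_real (r n) * cis t))" for t
  have m [measurable]: "(\<lambda>t. f (of_real (r n) * cis t)) \<in> borel_measurable circ" for n
    using r by (intro circle_measurable f)
  have [measurable]: "\<phi> \<in> borel_measurable circ" unfolding \<phi>_def by (intro borel_measurable_lim_metric m)
  have lim: "AE t in circ. (\<lambda>n. f (of_real (r n) * cis t)) \<longlonglongrightarrow> \<phi> t"
    using conv by eventually_elim (simp only: \<phi>_def convergent_LIMSEQ_iff[symmetric])
  have Cr: "cmod (f (of_real (r n) * cis t)) \<le> C" for n t
    using r by (intro C) (simp add: norm_mult)
  have int: "integrable circ \<phi>"
    by (rule integrable_dominated_convergence[OF _ m integrable_circ_const[of C] lim]) (use Cr in auto)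
  have rep: "f z = (LINT t|circ. of_real (poisson z t) * \<phi> t) / (2*pi)" if z: "cmod z < 1" for z
  proof -
    have "(\<lambda>n. LINT t|circ. of_real (poisson z t) * f (of_real (r n) * cis t)) \<longlonglongrightarrow> (LINT t|circ. of_real (poisson z t) * \<phi> t)"
    proof (rule integral_dominated_convergence[where w="\<lambda>t. 2 / (1 - cmod z) * C"])
      show "AE t in circ. (\<lambda>n. of_real (poisson z t) * f (of_real (r n) * cis t)) \<longlonglongrightarrow> of_real (poisson z t) * \<phi> t"
        using lim by eventually_elim (intro tendsto_intros)
      show "AE t in circ. cmod (of_real (poisson z t) * f (of_real (r n) * cis t)) \<le> 2 / (1 - cmod z) * C" for n
        unfolding norm_mult using poisson_nonneg[OF z] poisson_bound[OF z] z Cr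
        by (intro AE_I2 mult_mono) auto
      show "(\<lambda>t. of_real (poisson z t) * f (of_real (r n) * cis t)) \<in> borel_measurable circ" for n
        using z by measurable
      show "(\<lambda>t. of_real (poisson z t) * \<phi> t) \<in> borel_measurable circ"
        using z by measurable
    qed (rule integrable_circ_const)
    moreover have "(LINT t|circ. of_real (poisson z t) * f (of_real (r n) * cis t)) = 2*pi * f (of_real (r n) * z)" for n
      by (rule poisson_formula[OF f r(1,2) z])
    moreover have "(\<lambda>n. 2*pi * f (of_real (r n) * z)) \<longlonglongrightarrow> 2*pi * f (of_real 1 * z)"
    proof -
      have "isCont f z"
        using f z by (meson continuous_on_eq_continuous_at holomorphic_on_imp_continuous_on mem_ball_0 open_ball)
      then have "isCont f (of_real 1 * z)" by simp
      then have "(\<lambda>n. f (of_real (r n) * z)) \<longlonglongrightarrow> f (of_real 1 * z)"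
        by (rule isCont_tendsto_compose) (intro tendsto_intros r)
      then show ?thesis by (intro tendsto_mult tendsto_const)
    qed
    ultimately have "(LINT t|circ. of_real (poisson z t) * \<phi> t) = 2*pi * f z"
      using LIMSEQ_unique[of "\<lambda>n. 2*pi * f (of_real (r n) * z)"] by simp
    then show ?thesis by simp
  qed
  have "AE t in circ. ((\<lambda>r. f (of_real r * cis t)) \<longlongrightarrow> \<phi> t) (at_left 1)"
    using poisson_radial_limit[OF int]
  proof eventually_elim
    case (elim t)
    have "\<forall>\<^sub>F r in at_left (1::real). r \<in> {0<..<1}"
      by (rule eventually_at_left_real) simp
    then have "\<forall>\<^sub>F r in at_left 1. (LINT s|circ. of_real (poisson (of_real r * cis t) s) * \<phi> s) / (2*pi) = f (of_real r * cis t)"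
    proof eventually_elim
      case (elim r)
      then show ?case using rep[of "of_real r * cis t"] by (simp add: norm_mult)
    qed
    from tendsto_cong[OF this] elim show ?case by simp
  qed
  from that[OF int rep this] show ?thesis by simp
qed

lemma radial_limit_unique:
  fixes f :: "real \<Rightarrow> 'a::t2_space"
  shows "(f \<longlongrightarrow> a) (at_left (1::real)) \<Longrightarrow> (f \<longlongrightarrow> b) (at_left 1) \<Longrightarrow> a = b"
  using tendsto_unique[OF trivial_limit_at_left_real] .

text \<open>The Poisson kernel averages the boundary bound. \<open>C\<close> may exceed
  \<open>B\<close> by any amount, but some \<open>C\<close> must exist:
  \<open>exp ((1 + z) / (1 - z))\<close> is unbounded with unimodular radial limits almost
  everywhere.\<close>

lemma bounded_holomorphic_max_principle:
  assumes f: "f holomorphic_on ball 0 1" and C: "\<And>z. cmod z < 1 \<Longrightarrow> cmod (f z) \<le> C"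
    and B: "AE t in circ. \<exists>l. ((\<lambda>r. f (of_real r * cis t)) \<longlongrightarrow> l) (at_left 1) \<and> cmod l \<le> B"
    and z: "cmod z < 1"
  shows "cmod (f z) \<le> B"
proof -
  obtain \<phi> :: "real \<Rightarrow> complex" where \<phi>: "integrable circ \<phi>"
    "\<And>z. cmod z < 1 \<Longrightarrow> f z = (LINT t|circ. of_real (poisson z t) * \<phi> t) / (2*pi)"
    "AE t in circ. ((\<lambda>r. f (of_real r * cis t)) \<longlongrightarrow> \<phi> t) (at_left 1)"
    using bounded_holomorphic_boundary[OF f C] by blast
  have "AE t in circ. cmod (\<phi> t) \<le> B"
    using B \<phi>(3) by eventually_elim (metis radial_limit_unique)
  then have "AE t in circ. cmod (of_real (poisson z t) * \<phi> t) \<le> poisson z t * B"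
    by eventually_elim (use poisson_nonneg[OF z] in \<open>auto simp: norm_mult intro: mult_left_mono\<close>)
  moreover have "integrable circ (\<lambda>t. poisson z t * B)"
    using integrable_circ_const by (intro poisson_mult_integrable_real z)
  ultimately have "(LINT t|circ. cmod (of_real (poisson z t) * \<phi> t)) \<le> (LINT t|circ. poisson z t * B)"
    using poisson_mult_integrable[OF z \<phi>(1)] by (intro integral_mono_AE) auto
  also have "\<dots> = 2*pi * B" using integral_poisson[OF z] by simp
  finally have "cmod (LINT t|circ. of_real (poisson z t) * \<phi> t) \<le> 2*pi * B"
    by (rule order_trans[OF integral_norm_bound])
  then show ?thesis unfolding \<phi>(2)[OF z] norm_divide by (simp add: field_simps)
qed

section \<open>Outer functions and log-integrability\<close>

text \<open>Indexed by the logarithm \<open>u\<close> of the boundary modulus: taking square roots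
  halves \<open>u\<close>, and comparing moduli becomes comparing Poisson integrals of
  \<open>u\<close>.\<close>

definition outer_exp :: "(real \<Rightarrow> real) \<Rightarrow> complex \<Rightarrow> complex" where
  "outer_exp u z = exp (1 / (2 * of_real pi) * (LINT t|circ. herglotz z t * of_real (u t)))"

lemma outer_exp_nonzero [simp]: "outer_exp u z \<noteq> 0"
  by (simp add: outer_exp_def)

lemma outer_exp_holomorphic:
  assumes "integrable circ u"
  shows "outer_exp u holomorphic_on ball 0 1"
  unfolding outer_exp_def
  using assms by (intro holomorphic_intros herglotz_integral_holomorphic) auto

lemma norm_outer_exp:
  assumes "integrable circ u" "cmod z < 1"
  shows "cmod (outer_exp u z) = exp ((LINT t|circ. poisson z t * u t) / (2*pi))"
proof -
  have "Re (1 / (2 * of_real pi) * (LINT t|circ. herglotz z t * of_real (u t)))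
     = (LINT t|circ. poisson z t * u t) / (2*pi)"
    using integral_poisson_real[OF assms(2,1)] Re_divide_of_real[of _ "2*pi"]
    by (simp add: field_simps)
  then show ?thesis by (simp only: outer_exp_def norm_exp_eq_Re)
qed

lemma outer_exp_zero: "outer_exp u 0 = of_real (exp ((LINT t|circ. u t) / (2*pi)))"
proof -
  have "(LINT t|circ. herglotz 0 t * of_real (u t)) = of_real (LINT t|circ. u t)"
    by (simp add: herglotz_def)
  then show ?thesis by (simp add: outer_exp_def flip: exp_of_real)
qed

lemma outer_exp_radial_limit:
  assumes u: "integrable circ u"
  shows "AE t in circ. ((\<lambda>r. cmod (outer_exp u (of_real r * cis t))) \<longlongrightarrow> exp (u t)) (at_left 1)"
  using poisson_radial_limit_real[OF u]
proof eventually_elim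
  case (elim t)
  then have lim: "((\<lambda>r. exp ((LINT s|circ. poisson (of_real r * cis t) s * u s) / (2*pi))) \<longlongrightarrow> exp (u t)) (at_left 1)"
    by (intro tendsto_intros)
  have "\<forall>\<^sub>F r in at_left (1::real). r \<in> {0<..<1}"
    by (rule eventually_at_left_real) simp
  then have "\<forall>\<^sub>F r in at_left 1. exp ((LINT s|circ. poisson (of_real r * cis t) s * u s) / (2*pi)) = cmod (outer_exp u (of_real r * cis t))"
  proof eventually_elim
    case (elim r)
    then show ?case by (intro norm_outer_exp[OF u, symmetric]) (simp add: norm_mult)
  qed
  from tendsto_cong[OF this] lim show ?case by simp
qed

lemma poisson_integral_mono:
  assumes u: "integrable circ u" and v: "integrable circ v" and z: "cmod z < 1"
    and le: "AE t in circ. u t \<le> v t"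
  shows "(LINT t|circ. poisson z t * u t) \<le> (LINT t|circ. poisson z t * v t)"
proof (rule integral_mono_AE)
  show "AE t in circ. poisson z t * u t \<le> poisson z t * v t"
    using le by eventually_elim (intro mult_left_mono poisson_nonneg z)
qed (intro poisson_mult_integrable_real u v z)+

lemma norm_outer_exp_le:
  assumes u: "integrable circ u" and z: "cmod z < 1" and le: "AE t in circ. u t \<le> b"
  shows "cmod (outer_exp u z) \<le> exp b"
proof -
  have "(LINT t|circ. poisson z t * u t) \<le> (LINT t|circ. poisson z t * b)"
    by (rule poisson_integral_mono[OF u integrable_circ_const z le])
  also have "\<dots> = 2*pi * b" using integral_poisson[OF z] by simp
  finally show ?thesis unfolding norm_outer_exp[OF u z] by (simp add: field_simps)
qed

lemma norm_outer_exp_ge: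
  assumes u: "integrable circ u" and z: "cmod z < 1" and le: "AE t in circ. b \<le> u t"
  shows "exp b \<le> cmod (outer_exp u z)"
proof -
  have "2*pi * b = (LINT t|circ. poisson z t * b)" using integral_poisson[OF z] by simp
  also have "\<dots> \<le> (LINT t|circ. poisson z t * u t)"
    by (rule poisson_integral_mono[OF integrable_circ_const u z le])
  finally show ?thesis unfolding norm_outer_exp[OF u z] by (simp add: field_simps)
qed

lemma outer_exp_cong:
  assumes u: "integrable circ u" and v: "integrable circ v" and z: "cmod z < 1"
    and eq: "AE t in circ. u t = v t"
  shows "outer_exp u z = outer_exp v z"
proof -
  have "(LINT t|circ. herglotz z t * of_real (u t)) = (LINT t|circ. herglotz z t * of_real (v t))"
  proof (rule integral_cong_AE)
    show "AE t in circ. herglotz z t * of_real (u t) = herglotz z t * of_real (v t)"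
      using eq by eventually_elim simp
  qed (use u v z in \<open>auto intro!: borel_measurable_times herglotz_measurable\<close>)
  then show ?thesis by (simp add: outer_exp_def)
qed

text \<open>Harnack's bound with the denominator \<open>1 + cmod z\<close> replaced by 2. It
  converts a Poisson mean at one point into a bound for the plain integral over the circle.\<close>

lemma poisson_lower_bound:
  assumes z: "cmod z < 1"
  shows "(1 - cmod z) / 2 \<le> poisson z t"
proof -
  have ne: "0 < cmod (cis t - z)" using cis_minus_nonzero[OF z] by simp
  have "cmod (cis t - z) \<le> 1 + cmod z" using norm_triangle_ineq4[of "cis t" z] by simp
  then have le: "(cmod (cis t - z))\<^sup>2 \<le> (1 + cmod z)\<^sup>2" by (intro power_mono) auto
  have "(1 - cmod z) / 2 \<le> (1 - cmod z) / (1 + cmod z)" using z by (intro divide_left_mono) (auto simp: add_pos_nonneg)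
  also have "\<dots> = (1 - (cmod z)\<^sup>2) / (1 + cmod z)\<^sup>2"
  proof -
    have "1 - (cmod z)\<^sup>2 = (1 - cmod z) * (1 + cmod z)" by (simp add: power2_eq_square algebra_simps)
    moreover have "1 + cmod z \<noteq> 0" using norm_ge_zero[of z] by linarith
    ultimately show ?thesis by (simp add: power2_eq_square)
  qed
  also have "\<dots> \<le> poisson z t" unfolding poisson_eq using le ne z
    by (intro frac_le) (auto simp: power_le_one)
  finally show ?thesis .
qed

text \<open>Truncation at \<open>e\<close> keeps the outer function \<open>h\<close> with
  log-modulus \<open>v\<close> away from 0, so \<open>f / h\<close> is bounded; its radial limits
  have modulus at most 1, and the maximum principle applies.\<close>

lemma norm_le_truncated_outer:
  assumes f: "f holomorphic_on ball 0 1" and C: "\<And>z. cmod z < 1 \<Longrightarrow> cmod (f z) \<le> C"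
    and C1: "1 \<le> C" and e: "0 < e" "e \<le> 1"
    and \<phi>: "integrable circ \<phi>" "AE t in circ. ((\<lambda>r. f (of_real r * cis t)) \<longlongrightarrow> \<phi> t) (at_left 1)"
  defines "v \<equiv> \<lambda>t. ln (max (cmod (\<phi> t)) e)"
  shows "integrable circ v" "\<And>t. ln e \<le> v t" "AE t in circ. v t \<le> ln C"
    "\<And>z. cmod z < 1 \<Longrightarrow> cmod (f z) \<le> cmod (outer_exp v z)"
proof -
  have ev: "\<forall>\<^sub>F r in at_left (1::real). r \<in> {0<..<1}"
    by (rule eventually_at_left_real) simp
  have \<phi>C: "AE t in circ. cmod (\<phi> t) \<le> C"
    using \<phi>(2)
  proof eventually_elim
    case (elim t)
    have "\<forall>\<^sub>F r in at_left 1. cmod (f (of_real r * cis t)) \<le> C"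
      using ev by eventually_elim (intro C, simp add: norm_mult)
    with tendsto_norm[OF elim] show ?case by (rule tendsto_upperbound) simp
  qed
  show lo: "ln e \<le> v t" for t unfolding v_def using e by simp
  show up: "AE t in circ. v t \<le> ln C"
    using \<phi>C by eventually_elim (use e C1 in \<open>simp add: v_def\<close>)
  have [measurable]: "\<phi> \<in> borel_measurable circ" using \<phi>(1) by auto
  have vm: "v \<in> borel_measurable circ" unfolding v_def by measurable
  show int: "integrable circ v"
  proof (rule Bochner_Integration.integrable_bound[OF integrable_circ_const vm])
    show "AE t in circ. norm (v t) \<le> norm (\<bar>ln e\<bar> + \<bar>ln C\<bar>)"
      using up by eventually_elim (use lo in \<open>smt (verit) real_norm_def\<close>)
  qed
  define h where "h = outer_exp v"
  have h: "h holomorphic_on ball 0 1" unfolding h_def by (rule outer_exp_holomorphic[OF int])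
  have hup: "cmod (h z) \<le> C" if "cmod z < 1" for z
    using norm_outer_exp_le[OF int that up] C1 by (simp add: h_def)
  have hlo: "e \<le> cmod (h z)" if "cmod z < 1" for z
    using norm_outer_exp_ge[OF int that, of "ln e"] lo e by (simp add: h_def)
  obtain \<psi> where \<psi>: "AE t in circ. ((\<lambda>r. h (of_real r * cis t)) \<longlongrightarrow> \<psi> t) (at_left 1)"
    using bounded_holomorphic_boundary[OF h hup] by blast
  have q: "(\<lambda>z. f z / h z) holomorphic_on ball 0 1"
    by (intro holomorphic_on_divide f h) (simp add: h_def)
  have "AE t in circ. \<exists>l. ((\<lambda>r. f (of_real r * cis t) / h (of_real r * cis t)) \<longlongrightarrow> l) (at_left 1) \<and> cmod l \<le> 1"
    using \<phi>(2) \<psi> outer_exp_radial_limit[OF int]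
  proof eventually_elim
    case (elim t)
    have "cmod (\<psi> t) = exp (v t)"
      using tendsto_norm[OF elim(2)] elim(3) unfolding h_def by (rule radial_limit_unique)
    then have eq: "cmod (\<psi> t) = max (cmod (\<phi> t)) e" using e by (simp add: v_def)
    then have "\<psi> t \<noteq> 0" using e by auto
    from tendsto_divide[OF elim(1,2) this] eq e show ?case
      by (intro exI[of _ "\<phi> t / \<psi> t"]) (auto simp: norm_divide divide_le_eq)
  qed
  moreover have "cmod (f z / h z) \<le> C / e" if "cmod z < 1" for z
    unfolding norm_divide using C[OF that] hlo[OF that] e C1 by (intro frac_le) auto
  ultimately show "cmod (f z) \<le> cmod (outer_exp v z)" if z: "cmod z < 1" for z
    using bounded_holomorphic_max_principle[OF q _ _ z, of "C / e" 1]
    by (simp add: norm_divide h_def divide_le_eq)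
qed

text \<open>
  The outer functions with boundary moduli \<open>max \<bar>\<phi>\<bar> \<epsilon>\<close> dominate \<open>\<bar>f\<bar>\<close>; letting \<open>\<epsilon>\<close> tend to \<open>0\<close>
  takes the place of Jensen's formula and of the zeros of \<open>f\<close>.
\<close>

theorem log_boundary_integrable:
  assumes f: "f holomorphic_on ball 0 1" and C: "\<And>z. cmod z < 1 \<Longrightarrow> cmod (f z) \<le> C"
    and z0: "cmod z0 < 1" "f z0 \<noteq> 0"
    and \<phi>: "integrable circ \<phi>" "AE t in circ. ((\<lambda>r. f (of_real r * cis t)) \<longlongrightarrow> \<phi> t) (at_left 1)"
  shows "AE t in circ. \<phi> t \<noteq> 0" "integrable circ (\<lambda>t. ln (cmod (\<phi> t)))"
    "\<And>z. cmod z < 1 \<Longrightarrow> cmod (f z) \<le> cmod (outer_exp (\<lambda>t. ln (cmod (\<phi> t))) z)"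
proof -
  define D where "D = max C 1"
  have D: "cmod (f z) \<le> D" if "cmod z < 1" for z using C[OF that] by (simp add: D_def)
  have D1: "1 \<le> D" by (simp add: D_def)
  define v where "v n t = ln (max (cmod (\<phi> t)) (1 / real (Suc n)))" for n t
  have v: "integrable circ (v n)" "\<And>t. ln (1 / real (Suc n)) \<le> v n t" "AE t in circ. v n t \<le> ln D"
    "\<And>z. cmod z < 1 \<Longrightarrow> cmod (f z) \<le> cmod (outer_exp (v n) z)" for n
    using norm_le_truncated_outer[OF f D D1 _ _ \<phi>, of "1 / real (Suc n)"] unfolding v_def by auto
  have [measurable]: "\<phi> \<in> borel_measurable circ" using \<phi>(1) by auto
  have [measurable]: "v n \<in> borel_measurable circ" for n using v(1) by auto
  have vmono: "v n t \<le> v m t" if "m \<le> n" for m n t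
    unfolding v_def using that by (intro ln_mono max.mono) (auto simp: frac_le max_def)
  define c where "c = (1 - cmod z0) / 2"
  have c: "0 < c" using z0 by (simp add: c_def)
  \<comment> \<open>By Harnack, \<open>c\<close> times the integral of \<open>ln D - v n\<close> is
    at most its Poisson mean at \<open>z0\<close>, which is at most
    \<open>2*pi * (ln D - ln (cmod (f z0)))\<close> because the truncated outer function dominates
    \<open>f\<close> there. Nothing depends on \<open>n\<close>.\<close>
  define B where "B = 2*pi * (ln D - ln (cmod (f z0))) / c"
  have bound: "(LINT t|circ. ln D - v n t) \<le> B" for n
  proof -
    have i: "integrable circ (\<lambda>t. ln D - v n t)" using v(1) integrable_circ_const by auto
    have "c * (LINT t|circ. ln D - v n t) = (LINT t|circ. c * (ln D - v n t))" by simp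
    also have "\<dots> \<le> (LINT t|circ. poisson z0 t * (ln D - v n t))"
    proof (rule integral_mono_AE)
      show "AE t in circ. c * (ln D - v n t) \<le> poisson z0 t * (ln D - v n t)"
        using v(3)[of n]
      proof eventually_elim
        case (elim t)
        then show ?case unfolding c_def using poisson_lower_bound[OF z0(1)] by (intro mult_right_mono) auto
      qed
    qed (use i z0 in \<open>auto intro: poisson_mult_integrable_real\<close>)
    also have "\<dots> = (LINT t|circ. poisson z0 t * ln D) - (LINT t|circ. poisson z0 t * v n t)"
      unfolding right_diff_distrib
      by (intro Bochner_Integration.integral_diff poisson_mult_integrable_real z0 v(1) integrable_circ_const)
    also have "(LINT t|circ. poisson z0 t * ln D) = 2*pi * ln D"
      using integral_poisson[OF z0(1)] by simp
    finally have upper: "c * (LINT t|circ. ln D - v n t) \<le> 2*pi * ln D - (LINT t|circ. poisson z0 t * v n t)" .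
    have "2*pi * ln (cmod (f z0)) \<le> (LINT t|circ. poisson z0 t * v n t)"
    proof -
      have "ln (cmod (f z0)) \<le> ln (exp ((LINT t|circ. poisson z0 t * v n t) / (2*pi)))"
        using v(4)[OF z0(1), of n] z0 unfolding norm_outer_exp[OF v(1) z0(1)] by (intro ln_mono) auto
      then show ?thesis by (simp add: field_simps)
    qed
    with upper show ?thesis using c by (simp add: B_def field_simps)
  qed
  \<comment> \<open>The integrands increase with \<open>n\<close>, so monotone convergence bounds
    the integral of the supremum by \<open>B\<close>; at a zero of \<open>\<phi>\<close> the
    supremum would be infinite.\<close>
  define S where "S t = (SUP n. ennreal (ln D - v n t))" for t
  have "(\<integral>\<^sup>+ t. S t \<partial>circ) = (SUP n. \<integral>\<^sup>+ t. ennreal (ln D - v n t) \<partial>circ)"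
    unfolding S_def
  proof (rule nn_integral_monotone_convergence_SUP)
    show "incseq (\<lambda>n t. ennreal (ln D - v n t))"
      using vmono by (auto simp: incseq_def le_fun_def intro!: ennreal_leI)
  qed measurable
  also have "\<dots> \<le> ennreal B"
  proof (rule SUP_least)
    fix n
    have "(\<integral>\<^sup>+ t. ennreal (ln D - v n t) \<partial>circ) = ennreal (LINT t|circ. ln D - v n t)"
      using v(1,3)[of n] integrable_circ_const by (intro nn_integral_eq_integral) auto
    then show "(\<integral>\<^sup>+ t. ennreal (ln D - v n t) \<partial>circ) \<le> ennreal B"
      using bound[of n] by (simp add: ennreal_leI)
  qed
  finally have S: "(\<integral>\<^sup>+ t. S t \<partial>circ) \<le> ennreal B" .
  have Sm [measurable]: "S \<in> borel_measurable circ" unfolding S_def by measurable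
  have "AE t in circ. S t \<noteq> \<infinity>"
    using S by (intro nn_integral_PInf_AE) (auto simp: top_unique)
  then show nz: "AE t in circ. \<phi> t \<noteq> 0"
  proof eventually_elim
    case (elim t)
    show ?case
    proof
      assume 0: "\<phi> t = 0"
      obtain x where x: "0 \<le> x" "S t = ennreal x" using elim by (cases "S t") auto
      obtain n where n: "exp (x + 1) < real n" using reals_Archimedean2 by blast
      have "exp (x + 1) \<le> real (Suc n)" using n by simp
      then have "x + 1 \<le> ln (real (Suc n))" by (subst ln_ge_iff) auto
      then have "x + 1 \<le> ln D - v n t"
        using D1 by (simp add: v_def 0 ln_div) (smt (verit) ln_ge_zero)
      moreover have "ennreal (ln D - v n t) \<le> S t" unfolding S_def by (rule SUP_upper) simp
      ultimately show False using x ennreal_le_iff[of x "ln D - v n t"] by auto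
    qed
  qed
  have ev: "\<forall>\<^sub>F n in sequentially. v n t = ln (cmod (\<phi> t))" if nz: "\<phi> t \<noteq> 0" for t
  proof -
    obtain N where N: "inverse (real (Suc N)) < cmod (\<phi> t)"
      using reals_Archimedean[of "cmod (\<phi> t)"] nz by auto
    show ?thesis
    proof (rule eventually_sequentiallyI[of N])
      fix n assume "N \<le> n"
      then have "1 / real (Suc n) \<le> 1 / real (Suc N)" by (intro frac_le) auto
      then show "v n t = ln (cmod (\<phi> t))" using N unfolding v_def by (simp add: inverse_eq_divide max_absorb1)
    qed
  qed
  have "integrable circ (\<lambda>t. ln D - ln (cmod (\<phi> t)))"
  proof (rule integrableI_nonneg)
    have le: "AE t in circ. \<forall>n. v n t \<le> ln D" using v(3) by (simp add: AE_all_countable)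
    show "AE t in circ. 0 \<le> ln D - ln (cmod (\<phi> t))"
      using le nz
    proof eventually_elim
      case (elim t)
      from eventually_happens'[OF _ ev[OF elim(2)]] obtain n where "v n t = ln (cmod (\<phi> t))" by auto
      with elim(1) show ?case by (metis diff_ge_0_iff_ge)
    qed
    have "(\<integral>\<^sup>+ t. ennreal (ln D - ln (cmod (\<phi> t))) \<partial>circ) \<le> (\<integral>\<^sup>+ t. S t \<partial>circ)"
    proof (rule nn_integral_mono_AE)
      show "AE t in circ. ennreal (ln D - ln (cmod (\<phi> t))) \<le> S t"
        using nz
      proof eventually_elim
        case (elim t)
        from eventually_happens'[OF _ ev[OF elim]] obtain n where "v n t = ln (cmod (\<phi> t))" by auto
        then show ?case unfolding S_def by (intro SUP_upper2[of n]) auto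
      qed
    qed
    also note S
    finally show "(\<integral>\<^sup>+ t. ennreal (ln D - ln (cmod (\<phi> t))) \<partial>circ) < \<infinity>"
      by (simp add: le_less_trans[OF _ ennreal_less_top])
  qed measurable
  from Bochner_Integration.integrable_diff[OF integrable_circ_const[of "ln D"] this]
  show int: "integrable circ (\<lambda>t. ln (cmod (\<phi> t)))" by simp
  show "cmod (f z) \<le> cmod (outer_exp (\<lambda>t. ln (cmod (\<phi> t))) z)" if z: "cmod z < 1" for z
  proof -
    \<comment> \<open>As \<open>1 / real (Suc n) \<le> 1\<close>, truncation only moves a negative
      logarithm towards 0; this gives the majorant for dominated convergence.\<close>
    have bd: "\<bar>v n t\<bar> \<le> \<bar>ln (cmod (\<phi> t))\<bar>" if "\<phi> t \<noteq> 0" for n t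
    proof (cases "1 / real (Suc n) \<le> cmod (\<phi> t)")
      case True
      then show ?thesis by (simp add: v_def max_absorb1)
    next
      case False
      then have "v n t = ln (1 / real (Suc n))" by (simp add: v_def max_absorb2)
      moreover have "ln (1 / real (Suc n)) \<le> 0" by (simp add: ln_div)
      moreover have "ln (cmod (\<phi> t)) \<le> ln (1 / real (Suc n))" using False that by (intro ln_mono) auto
      ultimately show ?thesis by linarith
    qed
    have "(\<lambda>n. LINT t|circ. poisson z t * v n t) \<longlonglongrightarrow> (LINT t|circ. poisson z t * ln (cmod (\<phi> t)))"
    proof (rule integral_dominated_convergence[where w="\<lambda>t. poisson z t * \<bar>ln (cmod (\<phi> t))\<bar>"])
      show "AE t in circ. (\<lambda>n. poisson z t * v n t) \<longlonglongrightarrow> poisson z t * ln (cmod (\<phi> t))"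
        using nz
      proof eventually_elim
        case (elim t)
        from tendsto_mult[OF tendsto_const tendsto_eventually[OF ev[OF elim]]] show ?case .
      qed
      show "AE t in circ. norm (poisson z t * v n t) \<le> poisson z t * \<bar>ln (cmod (\<phi> t))\<bar>" for n
        using nz by eventually_elim (use poisson_nonneg[OF z] bd in \<open>auto simp: abs_mult intro: mult_left_mono\<close>)
      show "integrable circ (\<lambda>t. poisson z t * \<bar>ln (cmod (\<phi> t))\<bar>)"
        using int by (intro poisson_mult_integrable_real z) auto
    qed (use z in measurable)
    then have "(\<lambda>n. cmod (outer_exp (v n) z)) \<longlonglongrightarrow> cmod (outer_exp (\<lambda>t. ln (cmod (\<phi> t))) z)"
      unfolding norm_outer_exp[OF v(1) z] norm_outer_exp[OF int z] by (intro tendsto_intros) auto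
    then show ?thesis by (rule LIMSEQ_le_const) (use v(4)[OF z] in auto)
  qed
qed

section \<open>Points of the closed tetrablock and contractions\<close>

text \<open>Otherwise \<open>a / b\<close> is a zero in the disc.\<close>

lemma norm_le_if_no_zero:
  fixes a b :: complex
  assumes "\<And>z. cmod z < 1 \<Longrightarrow> a - b * z \<noteq> 0"
  shows "cmod b \<le> cmod a"
proof (rule ccontr)
  assume less: "\<not> cmod b \<le> cmod a"
  then have b: "b \<noteq> 0" by auto
  then have "cmod (a / b) < 1" using less by (simp add: norm_divide)
  from assms[OF this] b show False by simp
qed

text \<open>Take \<open>w = r * u\<close> with \<open>u\<close> unimodular rotating \<open>c\<close>
  onto the nonnegative axis, and let \<open>r\<close> tend to 1; the term with \<open>B\<close>
  disappears, whatever its sign.\<close>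

lemma two_norm_le_if_Re_mult_le:
  fixes c :: complex and A :: real
  assumes "\<And>w. cmod w < 1 \<Longrightarrow> 2 * Re (c * w) \<le> A + B * (1 - (cmod w)\<^sup>2)"
  shows "2 * cmod c \<le> A"
proof -
  obtain u where u: "cmod u = 1" "c * u = of_real (cmod c)"
  proof (cases "c = 0")
    case True then show ?thesis using that[of 1] by simp
  next
    case False
    then have "c * cnj (c / of_real (cmod c)) = of_real (cmod c)"
      by (simp add: complex_norm_square[symmetric] power2_eq_square)
    moreover have "cmod (cnj (c / of_real (cmod c))) = 1" using False by (simp add: norm_divide)
    ultimately show ?thesis using that by blast
  qed
  have "\<forall>\<^sub>F r in at_left (1::real). r \<in> {0<..<1}"
    by (rule eventually_at_left_real) simp
  then have ev: "\<forall>\<^sub>F r in at_left 1. 2 * (r * cmod c) \<le> A + B * (1 - r\<^sup>2)"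
  proof eventually_elim
    case (elim r)
    have "c * (of_real r * u) = of_real (r * cmod c)" using u(2) by (simp add: mult.left_commute)
    then have "Re (c * (of_real r * u)) = r * cmod c" by (metis Re_complex_of_real)
    then show ?case using assms[of "of_real r * u"] elim u(1) by (simp add: norm_mult)
  qed
  have l1: "((\<lambda>r. A + B * (1 - r\<^sup>2)) \<longlongrightarrow> A + B * (1 - 1\<^sup>2)) (at_left 1)" by (intro tendsto_intros)
  have l2: "((\<lambda>r. 2 * (r * cmod c)) \<longlongrightarrow> 2 * (1 * cmod c)) (at_left 1)" by (intro tendsto_intros)
  from tendsto_le[OF trivial_limit_at_left_real l1 l2 ev] show ?thesis by simp
qed

text \<open>Squaring leaves a term linear in \<open>w\<close> and a multiple of
  \<open>(cmod w)^2\<close>; writing the latter through \<open>1 - (cmod w)^2\<close> gives the form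
  of \<open>two_norm_le_if_Re_mult_le\<close>.\<close>

lemma tetrablock_slice:
  fixes x1 x2 x3 :: complex
  assumes "\<And>w. cmod w < 1 \<Longrightarrow> cmod (x1 - x3 * w) \<le> cmod (1 - x2 * w)"
  shows "2 * cmod (x2 - cnj x1 * x3) \<le> 1 - (cmod x1)\<^sup>2 + (cmod x2)\<^sup>2 - (cmod x3)\<^sup>2"
proof (rule two_norm_le_if_Re_mult_le[where B="(cmod x3)\<^sup>2 - (cmod x2)\<^sup>2"])
  fix w :: complex assume "cmod w < 1"
  then have "(cmod (x1 - x3 * w))\<^sup>2 \<le> (cmod (1 - x2 * w))\<^sup>2" by (intro power_mono assms) auto
  then show "2 * Re ((x2 - cnj x1 * x3) * w) \<le> 1 - (cmod x1)\<^sup>2 + (cmod x2)\<^sup>2 - (cmod x3)\<^sup>2 +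
      ((cmod x3)\<^sup>2 - (cmod x2)\<^sup>2) * (1 - (cmod w)\<^sup>2)"
    unfolding cmod_power2 by (simp add: power2_eq_square algebra_simps)
qed

text \<open>For fixed \<open>w\<close> the defining expression is affine in \<open>z\<close>, so the
  absence of zeros compares its two coefficients; likewise with the roles exchanged. The last
  inequality follows from these slices in squared form, and the sign of its right-hand side needs a
  separate argument.\<close>

lemma closed_tetrablock_bounds:
  assumes x: "x \<in> closed_tetrablock"
  shows "cmod (x$1) \<le> 1" "cmod (x$2) \<le> 1" "cmod (x$3) \<le> 1"
    "2 * cmod (x$1 * x$2 - x$3) \<le> 1 - (cmod (x$1))\<^sup>2 - (cmod (x$2))\<^sup>2 + (cmod (x$3))\<^sup>2"
proof -
  define x1 x2 x3 where "x1 = x$1" and "x2 = x$2" and "x3 = x$3"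
  have nz: "1 - x1 * z - x2 * w + x3 * z * w \<noteq> 0" if "cmod z < 1" "cmod w < 1" for z w
    using x that by (auto simp: closed_tetrablock_def x1_def x2_def x3_def)
  have s1: "cmod (x1 - x3 * w) \<le> cmod (1 - x2 * w)" if w: "cmod w < 1" for w
    by (rule norm_le_if_no_zero) (use nz[OF _ w] in \<open>simp add: algebra_simps\<close>)
  have s2: "cmod (x2 - x3 * w) \<le> cmod (1 - x1 * w)" if w: "cmod w < 1" for w
    by (rule norm_le_if_no_zero) (use nz[OF w] in \<open>simp add: algebra_simps\<close>)
  have A1: "2 * cmod (x2 - cnj x1 * x3) \<le> 1 - (cmod x1)\<^sup>2 + (cmod x2)\<^sup>2 - (cmod x3)\<^sup>2"
    by (rule tetrablock_slice[OF s1])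
  have A2: "2 * cmod (x1 - cnj x2 * x3) \<le> 1 - (cmod x2)\<^sup>2 + (cmod x1)\<^sup>2 - (cmod x3)\<^sup>2"
    by (rule tetrablock_slice[OF s2])
  have c1: "cmod x1 \<le> 1" using s1[of 0] by simp
  have c2: "cmod x2 \<le> 1" using s2[of 0] by simp
  have "0 \<le> 1 - (cmod x3)\<^sup>2"
    using A1 A2 norm_ge_zero[of "x2 - cnj x1 * x3"] norm_ge_zero[of "x1 - cnj x2 * x3"] by linarith
  then have c3: "cmod x3 \<le> 1" by (simp add: power_le_one_iff)
  define b where "b = 1 - (cmod x1)\<^sup>2 - (cmod x2)\<^sup>2 + (cmod x3)\<^sup>2"
  have "(2 * cmod (x2 - cnj x1 * x3))\<^sup>2 \<le> (1 - (cmod x1)\<^sup>2 + (cmod x2)\<^sup>2 - (cmod x3)\<^sup>2)\<^sup>2"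
    using A1 by (intro power_mono) auto
  \<comment> \<open>The polynomial identity that trades \<open>x2 - cnj x1 * x3\<close> for
    \<open>x1 * x2 - x3\<close>.\<close>
  moreover have "(1 - (cmod x1)\<^sup>2 + (cmod x2)\<^sup>2 - (cmod x3)\<^sup>2)\<^sup>2 - (2 * cmod (x2 - cnj x1 * x3))\<^sup>2
     = b\<^sup>2 - (2 * cmod (x1 * x2 - x3))\<^sup>2"
    unfolding b_def power_mult_distrib[of 2] cmod_power2 by (simp add: power2_eq_square) algebra
  ultimately have sq: "(2 * cmod (x1 * x2 - x3))\<^sup>2 \<le> b\<^sup>2" by linarith
  have "0 \<le> b"
  proof (rule ccontr)
    \<comment> \<open>If \<open>b < 0\<close>, then \<open>1 - r \<le> \<bar>p - q\<bar>\<close> and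
      \<open>1 + r \<le> p + q\<close> with all moduli in the unit interval. One of
      \<open>p\<close>, \<open>q\<close> must then be 1 and the other \<open>r\<close>, where
      \<open>b = 0\<close>.\<close>
    assume neg: "\<not> 0 \<le> b"
    have abs: "2 * cmod (x1 * x2 - x3) \<le> - b"
      using abs_le_square_iff[THEN iffD2, OF sq] neg by simp
    define p q r where "p = cmod x1" and "q = cmod x2" and "r = cmod x3"
    have b: "b = 1 - p\<^sup>2 - q\<^sup>2 + r\<^sup>2" by (simp add: b_def p_def q_def r_def)
    have "\<bar>p * q - r\<bar> \<le> cmod (x1 * x2 - x3)"
      unfolding p_def q_def r_def norm_mult[symmetric] by (rule norm_triangle_ineq3)
    then have "2 * (p * q) - 2 * r \<le> - b" "2 * r - 2 * (p * q) \<le> - b" using abs by linarith+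
    then have "(1 - r)\<^sup>2 \<le> (p - q)\<^sup>2" "(1 + r)\<^sup>2 \<le> (p + q)\<^sup>2"
      unfolding b by (simp_all add: power2_eq_square algebra_simps)
    then have "\<bar>1 - r\<bar> \<le> \<bar>p - q\<bar>" "\<bar>1 + r\<bar> \<le> \<bar>p + q\<bar>"
      by (simp_all only: abs_le_square_iff)
    moreover have "0 \<le> p" "0 \<le> q" "0 \<le> r" "p \<le> 1" "q \<le> 1" "r \<le> 1"
      using c1 c2 c3 by (auto simp: p_def q_def r_def)
    ultimately have "(p = 1 \<and> q = r) \<or> (q = 1 \<and> p = r)" by linarith
    then have "b = 0" unfolding b by auto
    then show False using neg by simp
  qed
  then have "2 * cmod (x1 * x2 - x3) \<le> b" using abs_le_square_iff[THEN iffD2, OF sq] by simp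
  with c1 c2 c3 show "cmod (x$1) \<le> 1" "cmod (x$2) \<le> 1" "cmod (x$3) \<le> 1"
    "2 * cmod (x$1 * x$2 - x$3) \<le> 1 - (cmod (x$1))\<^sup>2 - (cmod (x$2))\<^sup>2 + (cmod (x$3))\<^sup>2"
    by (simp_all add: x1_def x2_def x3_def b_def)
qed

text \<open>The assumptions say that the Hermitian matrix with diagonal \<open>p\<close>,
  \<open>r\<close> and off-diagonal entry \<open>q\<close> has nonnegative trace and determinant. So
  \<open>p\<close> and \<open>r\<close> are nonnegative, and a square absorbs the mixed
  term.\<close>

lemma hermitian_form_nonneg:
  fixes p r :: real and q v w :: complex
  assumes "0 \<le> p + r" "(cmod q)\<^sup>2 \<le> p * r"
  shows "0 \<le> p * (cmod v)\<^sup>2 + r * (cmod w)\<^sup>2 + 2 * Re (cnj v * q * w)"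
proof -
  have "0 \<le> p * r" using assms(2) zero_le_power2[of "cmod q"] by linarith
  then have p: "0 \<le> p" "0 \<le> r" using assms(1) by (auto simp: zero_le_mult_iff)
  have "cmod q \<le> sqrt p * sqrt r"
    using real_le_rsqrt[OF assms(2)] by (simp add: real_sqrt_mult)
  then have "cmod (cnj v * q * w) \<le> cmod v * (sqrt p * sqrt r) * cmod w"
    unfolding norm_mult complex_mod_cnj by (intro mult_right_mono mult_left_mono) auto
  moreover have "- cmod (cnj v * q * w) \<le> Re (cnj v * q * w)"
    using abs_Re_le_cmod[of "cnj v * q * w"] by linarith
  ultimately have "- (cmod v * (sqrt p * sqrt r) * cmod w) \<le> Re (cnj v * q * w)" by linarith
  moreover have "0 \<le> (sqrt p * cmod v - sqrt r * cmod w)\<^sup>2" by simp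
  then have "0 \<le> p * (cmod v)\<^sup>2 + r * (cmod w)\<^sup>2 - 2 * (cmod v * (sqrt p * sqrt r) * cmod w)"
    using p by (simp add: power2_diff power_mult_distrib mult_ac)
  ultimately show ?thesis by linarith
qed

text \<open>\<open>p\<close>, \<open>q\<close>, \<open>r\<close> are the entries of the identity
  minus adjoint times matrix. Given \<open>cmod b = cmod c\<close>, the last assumption is the
  nonnegativity of its determinant; with the bound on the determinant of the original matrix it also
  gives the trace.\<close>

lemma contraction_if_tetrablock:
  fixes a b c d v w :: complex
  assumes "cmod b = cmod c" "cmod (a * d - b * c) \<le> 1"
    and "2 * cmod (b * c) \<le> 1 - (cmod a)\<^sup>2 - (cmod d)\<^sup>2 + (cmod (a * d - b * c))\<^sup>2"
  shows "(cmod (a * v + b * w))\<^sup>2 + (cmod (c * v + d * w))\<^sup>2 \<le> (cmod v)\<^sup>2 + (cmod w)\<^sup>2"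
proof -
  define p r q where "p = 1 - (cmod a)\<^sup>2 - (cmod c)\<^sup>2" and "r = 1 - (cmod b)\<^sup>2 - (cmod d)\<^sup>2"
    and "q = - (cnj a * b + cnj c * d)"
  have bc: "cmod (b * c) = (cmod b)\<^sup>2" "(cmod c)\<^sup>2 = (cmod b)\<^sup>2"
    using assms(1) by (simp_all add: norm_mult power2_eq_square)
  have "(cmod (a * d - b * c))\<^sup>2 \<le> 1" using assms(2) by (simp add: power_le_one)
  then have "0 \<le> p + r" using assms(3) unfolding bc p_def r_def by linarith
  moreover have "p * r - (cmod q)\<^sup>2 = 1 - (cmod a)\<^sup>2 - (cmod d)\<^sup>2 - (cmod b)\<^sup>2 - (cmod c)\<^sup>2 + (cmod (a * d - b * c))\<^sup>2"
    unfolding p_def q_def r_def cmod_power2 by (simp add: power2_eq_square) algebra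
  then have "(cmod q)\<^sup>2 \<le> p * r" using assms(3) unfolding bc by linarith
  ultimately have "0 \<le> p * (cmod v)\<^sup>2 + r * (cmod w)\<^sup>2 + 2 * Re (cnj v * q * w)" by (rule hermitian_form_nonneg)
  also have "\<dots> = (cmod v)\<^sup>2 + (cmod w)\<^sup>2 - ((cmod (a * v + b * w))\<^sup>2 + (cmod (c * v + d * w))\<^sup>2)"
    unfolding p_def q_def r_def cmod_power2 by (simp add: power2_eq_square) algebra
  finally show ?thesis by simp
qed

section \<open>Two by two matrices and the realization identity\<close>

lemma norm_vec2_sq: "(norm (v :: complex^2))\<^sup>2 = (cmod (v$1))\<^sup>2 + (cmod (v$2))\<^sup>2"
  by (simp add: norm_vec_def L2_set_def sum_2)

lemma matrix_vector_mult_2: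
  fixes A :: "complex^2^2"
  shows "(A *v v) $ i = A$i$1 * v$1 + A$i$2 * v$2"
  by (simp add: matrix_vector_mult_def sum_2)

lemma bounded_linear_matrix_vector:
  fixes A :: "complex^2^2"
  shows "bounded_linear ((*v) A)"
  by (simp add: linear_conv_bounded_linear[symmetric] matrix_vector_mul_linear)

lemma onorm_le_one_iff:
  fixes A :: "complex^2^2"
  shows "onorm ((*v) A) \<le> 1 \<longleftrightarrow> (\<forall>v. norm (A *v v) \<le> norm v)"
proof
  assume "onorm ((*v) A) \<le> 1"
  then show "\<forall>v. norm (A *v v) \<le> norm v"
    using onorm[OF bounded_linear_matrix_vector[of A]]
    by (meson mult_left_le_one_le norm_ge_zero onorm_pos_le bounded_linear_matrix_vector order_trans)
qed (auto intro: onorm_le)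

lemma entry_le_one:
  fixes A :: "complex^2^2"
  assumes "onorm ((*v) A) \<le> 1"
  shows "cmod (A $ i $ j) \<le> 1"
proof -
  have "A $ i $ j = (A *v axis j 1) $ i"
    by (simp add: matrix_vector_mult_def axis_def if_distrib cong: if_cong)
  also have "cmod \<dots> \<le> norm (A *v axis j 1)" by (rule Finite_Cartesian_Product.norm_nth_le)
  also have "\<dots> \<le> norm (axis j 1 :: complex^2)" using assms unfolding onorm_le_one_iff by blast
  also have "\<dots> = 1" by simp
  finally show ?thesis .
qed

lemma realization_identity:
  fixes F :: "complex \<Rightarrow> complex^2^2"
  assumes x: "x l = vector [F l $ 1 $ 1, F l $ 2 $ 2, det (F l)]"
      "x m = vector [F m $ 1 $ 1, F m $ 2 $ 2, det (F m)]"
    and nz: "1 - F m $ 2 $ 2 * w \<noteq> 0" "1 - F l $ 2 $ 2 * z \<noteq> 0"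
  shows "1 - cnj (Psi w (x m)) * Psi z (x l) =
         (1 - cnj w * z) * cnj (gamma_F F m w) * gamma_F F l z +
         sesq (eta_F F m w) ((mat 1 - conj_transpose (F m) ** F l) *v eta_F F l z)"
proof -
  \<comment> \<open>The two rows of \<open>F l *v eta_F F l z\<close>; the second is the definition
    of \<open>gamma_F\<close> with the denominator cleared.\<close>
  have Psi: "Psi z (x l) = F l $ 1 $ 1 + F l $ 1 $ 2 * (z * gamma_F F l z)"
    and gam: "gamma_F F l z = F l $ 2 $ 1 + F l $ 2 $ 2 * (z * gamma_F F l z)"
    if "x l = vector [F l $ 1 $ 1, F l $ 2 $ 2, det (F l)]" "1 - F l $ 2 $ 2 * z \<noteq> 0" for l z
  proof -
    have "F l $ 2 $ 2 * z - 1 \<noteq> 0" using that(2) by auto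
    then show "Psi z (x l) = F l $ 1 $ 1 + F l $ 1 $ 2 * (z * gamma_F F l z)"
      using that by (simp add: Psi_def gamma_F_def vector_3 det_2 field_simps)
    show "gamma_F F l z = F l $ 2 $ 1 + F l $ 2 $ 2 * (z * gamma_F F l z)"
      using that by (simp add: gamma_F_def field_simps)
  qed
  define g h where "g = gamma_F F l z" and "h = gamma_F F m w"
  have e: "eta_F F l z $ 1 = 1" "eta_F F l z $ 2 = z * g" "eta_F F m w $ 1 = 1" "eta_F F m w $ 2 = w * h"
    by (simp_all add: eta_F_def g_def h_def)
  have g: "g = F l $ 2 $ 1 + F l $ 2 $ 2 * (z * g)" unfolding g_def by (rule gam[OF x(1) nz(2)])
  have h: "cnj h = cnj (F m $ 2 $ 1) + cnj (F m $ 2 $ 2) * (cnj w * cnj h)"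
    unfolding h_def using arg_cong[OF gam[OF x(2) nz(1)], of cnj] by simp
  have "sesq (eta_F F m w) ((mat 1 - conj_transpose (F m) ** F l) *v eta_F F l z) =
     1 + cnj w * cnj h * (z * g) -
     cnj (F m $ 1 $ 1 + F m $ 1 $ 2 * (w * h)) * (F l $ 1 $ 1 + F l $ 1 $ 2 * (z * g)) -
     (cnj (F m $ 2 $ 1) + cnj (F m $ 2 $ 2) * (cnj w * cnj h)) * (F l $ 2 $ 1 + F l $ 2 $ 2 * (z * g))"
    unfolding sesq_def sum_2 matrix_vector_mult_2 e
    by (simp add: mat_def conj_transpose_def matrix_matrix_mult_def sum_2 algebra_simps)
  also have "\<dots> = 1 + cnj w * cnj h * (z * g) - cnj (Psi w (x m)) * Psi z (x l) - cnj h * g"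
    unfolding Psi[OF x(1) nz(2)] Psi[OF x(2) nz(1)] g_def[symmetric] h_def[symmetric]
    using g h by simp
  finally show ?thesis unfolding g_def[symmetric] h_def[symmetric] by (simp add: algebra_simps)
qed

section \<open>Factorisations balanced on the circle\<close>

lemma radial_limit_eqI:
  "((\<lambda>r. f (of_real r * cis t)) \<longlongrightarrow> l) (at_left 1) \<Longrightarrow> radial_limit f (cis t) = l"
  unfolding radial_limit_def by (intro tendsto_Lim trivial_limit_at_left_real)

lemma eventually_radius:
  "\<forall>\<^sub>F r in at_left 1. cmod (of_real r * cis t) < 1"
proof -
  have "\<forall>\<^sub>F r in at_left (1::real). r \<in> {0<..<1}"
    by (rule eventually_at_left_real) simp
  then show ?thesis by eventually_elim (simp add: norm_mult)
qed

lemma outer_exp_half_sq: "(outer_exp (\<lambda>t. u t / 2) z)\<^sup>2 = outer_exp u z"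
proof -
  have "(LINT t|circ. herglotz z t * of_real (u t / 2)) = (LINT t|circ. herglotz z t * of_real (u t)) / 2"
    by simp
  then show ?thesis unfolding outer_exp_def
    by (simp flip: exp_double)
qed

lemma outer_iff_outer_exp:
  "outer f \<longleftrightarrow> f holomorphic_on ball 0 1 \<and> bounded (f ` ball 0 1) \<and>
     (\<exists>c \<psi>. cmod c = 1 \<and> (\<forall>t\<in>{0..2*pi}. 0 < \<psi> t) \<and> \<psi> \<in> borel_measurable circ \<and>
        integrable circ (\<lambda>t. ln (\<psi> t)) \<and> (\<forall>z\<in>ball 0 1. f z = c * outer_exp (\<lambda>t. ln (\<psi> t)) z))"
  unfolding outer_def outer_exp_def herglotz_def ..

lemma bounded_holomorphic_boundary_le:
  assumes f: "f holomorphic_on ball 0 1" and C: "\<And>z. cmod z < 1 \<Longrightarrow> cmod (f z) \<le> C"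
  obtains \<phi> where "integrable circ \<phi>" "AE t in circ. cmod (\<phi> t) \<le> C"
    "AE t in circ. ((\<lambda>r. f (of_real r * cis t)) \<longlongrightarrow> \<phi> t) (at_left 1)"
proof -
  obtain \<phi> :: "real \<Rightarrow> complex" where \<phi>: "integrable circ \<phi>"
    "\<And>z. cmod z < 1 \<Longrightarrow> f z = (LINT t|circ. of_real (poisson z t) * \<phi> t) / (2*pi)"
    "AE t in circ. ((\<lambda>r. f (of_real r * cis t)) \<longlongrightarrow> \<phi> t) (at_left 1)"
    using bounded_holomorphic_boundary[OF f C] by blast
  have "AE t in circ. cmod (\<phi> t) \<le> C"
    using \<phi>(3)
  proof eventually_elim
    case (elim t)
    have "\<forall>\<^sub>F r in at_left 1. cmod (f (of_real r * cis t)) \<le> C"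
      using eventually_radius[of t] by eventually_elim (intro C)
    with tendsto_norm[OF elim] show ?case by (rule tendsto_upperbound) simp
  qed
  from that[OF \<phi>(1) this \<phi>(3)] show ?thesis by simp
qed

text \<open>The scalar part of \<open>tetrablock_lift\<close>, with \<open>p\<close> and
  \<open>q\<close> in the places of \<open>F\<^sub>1\<^sub>2\<close> and
  \<open>F\<^sub>2\<^sub>1\<close>. Contractivity is weakened to bounds on these two entries, so
  that existence and uniqueness become scalar questions; \<open>schur_if_balanced\<close> recovers
  it.\<close>

definition balanced_factors :: "(complex \<Rightarrow> complex) \<Rightarrow> (complex \<Rightarrow> complex) \<Rightarrow> (complex \<Rightarrow> complex) \<Rightarrow> bool" where
  "balanced_factors f p q \<longleftrightarrow>
     p holomorphic_on ball 0 1 \<and> q holomorphic_on ball 0 1 \<and>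
     (\<forall>z\<in>ball 0 1. cmod (p z) \<le> 1 \<and> cmod (q z) \<le> 1 \<and> f z = p z * q z) \<and>
     (AE t in circ. cmod (radial_limit p (cis t)) = cmod (radial_limit q (cis t))) \<and>
     ((\<forall>z\<in>ball 0 1. q z = 0) \<or> outer q) \<and> q 0 \<in> \<real>\<^sub>\<ge>\<^sub>0"

lemma balanced_factors_boundary:
  assumes "balanced_factors f p q"
  obtains \<pi> \<kappa> where
    "AE t in circ. ((\<lambda>r. p (of_real r * cis t)) \<longlongrightarrow> \<pi> t) (at_left 1) \<and>
       ((\<lambda>r. q (of_real r * cis t)) \<longlongrightarrow> \<kappa> t) (at_left 1) \<and> cmod (\<pi> t) = cmod (\<kappa> t)"
proof -
  have b: "p holomorphic_on ball 0 1" "q holomorphic_on ball 0 1"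
    "\<And>z. cmod z < 1 \<Longrightarrow> cmod (p z) \<le> 1" "\<And>z. cmod z < 1 \<Longrightarrow> cmod (q z) \<le> 1"
    "AE t in circ. cmod (radial_limit p (cis t)) = cmod (radial_limit q (cis t))"
    using assms by (auto simp: balanced_factors_def)
  obtain \<pi> where \<pi>: "AE t in circ. ((\<lambda>r. p (of_real r * cis t)) \<longlongrightarrow> \<pi> t) (at_left 1)"
    using bounded_holomorphic_boundary[OF b(1,3)] by blast
  obtain \<kappa> where \<kappa>: "AE t in circ. ((\<lambda>r. q (of_real r * cis t)) \<longlongrightarrow> \<kappa> t) (at_left 1)"
    using bounded_holomorphic_boundary[OF b(2,4)] by blast
  have "AE t in circ. ((\<lambda>r. p (of_real r * cis t)) \<longlongrightarrow> \<pi> t) (at_left 1) \<and>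
       ((\<lambda>r. q (of_real r * cis t)) \<longlongrightarrow> \<kappa> t) (at_left 1) \<and> cmod (\<pi> t) = cmod (\<kappa> t)"
    using \<pi> \<kappa> b(5)
  proof eventually_elim
    case (elim t)
    then show ?case using radial_limit_eqI[OF elim(1)] radial_limit_eqI[OF elim(2)] by simp
  qed
  from that[OF this] show ?thesis by simp
qed

text \<open>The factorisation says nothing about \<open>p\<close> when \<open>q\<close> vanishes.
  The balance on the circle does: the radial limits of \<open>p\<close> are 0, and the maximum
  principle applies with bound 0.\<close>

lemma balanced_factors_zero:
  assumes b: "balanced_factors f p q" and q: "\<And>z. cmod z < 1 \<Longrightarrow> q z = 0" and z: "cmod z < 1"
  shows "p z = 0"
proof -
  obtain \<pi> \<kappa> where lim: "AE t in circ. ((\<lambda>r. p (of_real r * cis t)) \<longlongrightarrow> \<pi> t) (at_left 1) \<and>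
       ((\<lambda>r. q (of_real r * cis t)) \<longlongrightarrow> \<kappa> t) (at_left 1) \<and> cmod (\<pi> t) = cmod (\<kappa> t)"
    using balanced_factors_boundary[OF b] by blast
  have "AE t in circ. \<exists>l. ((\<lambda>r. p (of_real r * cis t)) \<longlongrightarrow> l) (at_left 1) \<and> cmod l \<le> 0"
    using lim
  proof eventually_elim
    case (elim t)
    have "\<forall>\<^sub>F r in at_left 1. q (of_real r * cis t) = 0"
      using eventually_radius[of t] by eventually_elim (rule q)
    then have q0: "((\<lambda>r. q (of_real r * cis t)) \<longlongrightarrow> 0) (at_left 1)" by (rule tendsto_eventually)
    have pl: "((\<lambda>r. p (of_real r * cis t)) \<longlongrightarrow> \<pi> t) (at_left 1)" and eq: "cmod (\<pi> t) = cmod (\<kappa> t)"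
      using elim by simp_all
    have "\<kappa> t = 0" by (rule radial_limit_unique[OF _ q0]) (use elim in simp)
    then show ?case by (intro exI[of _ "\<pi> t"] conjI pl) (simp add: eq)
  qed
  moreover have "p holomorphic_on ball 0 1" "\<And>z. cmod z < 1 \<Longrightarrow> cmod (p z) \<le> 1"
    using b by (simp_all add: balanced_factors_def)
  ultimately have "cmod (p z) \<le> 0"
    using bounded_holomorphic_max_principle[OF _ _ _ z] by blast
  then show ?thesis by simp
qed

text \<open>On the circle \<open>cmod (\<phi> t)\<close> is the product of two equal moduli, hence
  the square of \<open>\<psi> t\<close>. So the log-modulus of \<open>q\<close> is half that of
  \<open>f\<close>, and \<open>q\<close> is expressed through \<open>f\<close> alone.\<close>

lemma balanced_factors_outer:
  assumes b: "balanced_factors f p q" and q: "outer q"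
    and \<phi>: "integrable circ \<phi>" "AE t in circ. ((\<lambda>r. f (of_real r * cis t)) \<longlongrightarrow> \<phi> t) (at_left 1)"
  shows "AE t in circ. \<phi> t \<noteq> 0"
    and "\<And>z. cmod z < 1 \<Longrightarrow> q z = outer_exp (\<lambda>t. ln (cmod (\<phi> t)) / 2) z"
proof -
  obtain c \<psi> where c: "cmod c = 1" and \<psi>: "\<And>t. t \<in> {0..2*pi} \<Longrightarrow> 0 < \<psi> t" "integrable circ (\<lambda>t. ln (\<psi> t))"
    and qc: "\<And>z. cmod z < 1 \<Longrightarrow> q z = c * outer_exp (\<lambda>t. ln (\<psi> t)) z"
    using q unfolding outer_iff_outer_exp mem_ball_0 Ball_def by metis
  \<comment> \<open>\<open>outer_exp\<close> is positive at 0, so \<open>q 0 \<ge> 0\<close> leaves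
    1 as the only unimodular constant.\<close>
  obtain e where e: "0 < e" "outer_exp (\<lambda>t. ln (\<psi> t)) 0 = of_real e"
    unfolding outer_exp_zero by (metis exp_gt_zero)
  have "q 0 \<in> \<real>\<^sub>\<ge>\<^sub>0" using b by (simp add: balanced_factors_def)
  then obtain k where k: "0 \<le> k" "q 0 = of_real k" by (auto elim: nonneg_Reals_cases)
  then have "c = of_real (k / e)" using qc[of 0] e by (simp add: field_simps)
  moreover from this have "k / e = 1" using c k e by (simp add: norm_divide)
  ultimately have "c = 1" by simp
  then have qe: "q z = outer_exp (\<lambda>t. ln (\<psi> t)) z" if "cmod z < 1" for z
    using qc[OF that] by simp
  obtain \<pi> \<kappa> where lim: "AE t in circ. ((\<lambda>r. p (of_real r * cis t)) \<longlongrightarrow> \<pi> t) (at_left 1) \<and>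
       ((\<lambda>r. q (of_real r * cis t)) \<longlongrightarrow> \<kappa> t) (at_left 1) \<and> cmod (\<pi> t) = cmod (\<kappa> t)"
    using balanced_factors_boundary[OF b] by blast
  have sq: "AE t in circ. cmod (\<phi> t) = (\<psi> t)\<^sup>2 \<and> 0 < \<psi> t"
    using lim \<phi>(2) outer_exp_radial_limit[OF \<psi>(2)] AE_space[of circ]
  proof eventually_elim
    case (elim t)
    then have pos: "0 < \<psi> t" using \<psi>(1) by simp
    have "\<forall>\<^sub>F r in at_left 1. cmod (q (of_real r * cis t)) = cmod (outer_exp (\<lambda>t. ln (\<psi> t)) (of_real r * cis t))"
      using eventually_radius[of t] by eventually_elim (simp add: qe)
    from tendsto_cong[OF this] elim(3) have "((\<lambda>r. cmod (q (of_real r * cis t))) \<longlongrightarrow> exp (ln (\<psi> t))) (at_left 1)"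
      by simp
    moreover have "((\<lambda>r. cmod (q (of_real r * cis t))) \<longlongrightarrow> cmod (\<kappa> t)) (at_left 1)"
      using elim(1) by (intro tendsto_norm) simp
    ultimately have "exp (ln (\<psi> t)) = cmod (\<kappa> t)" by (rule radial_limit_unique)
    then have \<kappa>: "cmod (\<kappa> t) = \<psi> t" using pos by simp
    have "((\<lambda>r. p (of_real r * cis t) * q (of_real r * cis t)) \<longlongrightarrow> \<pi> t * \<kappa> t) (at_left 1)"
      using elim(1) by (intro tendsto_mult) auto
    moreover have "\<forall>\<^sub>F r in at_left 1. f (of_real r * cis t) = p (of_real r * cis t) * q (of_real r * cis t)"
      using eventually_radius[of t] by eventually_elim (use b in \<open>simp add: balanced_factors_def\<close>)
    from tendsto_cong[OF this] have "((\<lambda>r. p (of_real r * cis t) * q (of_real r * cis t)) \<longlongrightarrow> \<phi> t) (at_left 1)"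
      using elim(2) by simp
    ultimately have "\<phi> t = \<pi> t * \<kappa> t" by (rule radial_limit_unique[symmetric])
    then show ?case using elim(1) \<kappa> pos by (simp add: norm_mult power2_eq_square)
  qed
  then show "AE t in circ. \<phi> t \<noteq> 0" by eventually_elim auto
  have eq: "AE t in circ. ln (\<psi> t) = ln (cmod (\<phi> t)) / 2"
    using sq by eventually_elim (simp add: ln_realpow)
  have [measurable]: "\<phi> \<in> borel_measurable circ" using \<phi>(1) by auto
  have "integrable circ (\<lambda>t. ln (cmod (\<phi> t)) / 2)"
  proof (rule integrable_cong_AE_imp[OF \<psi>(2)])
    show "AE t in circ. ln (\<psi> t) = ln (cmod (\<phi> t)) / 2" by (rule eq)
  qed measurable
  then show "q z = outer_exp (\<lambda>t. ln (cmod (\<phi> t)) / 2) z" if z: "cmod z < 1" for z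
    unfolding qe[OF z] by (intro outer_exp_cong \<psi>(2) z eq)
qed

text \<open>If one of \<open>q\<close>, \<open>q'\<close> is outer, \<open>f\<close> has nonzero
  radial limits almost everywhere and is not identically 0, so the other one is outer as well. Both
  equal the same \<open>outer_exp\<close>, which can be cancelled from
  \<open>f = p * q\<close>.\<close>

lemma balanced_factors_unique:
  assumes b1: "balanced_factors f p q" and b2: "balanced_factors f p' q'" and z: "cmod z < 1"
  shows "p z = p' z \<and> q z = q' z"
proof (cases "(\<forall>z\<in>ball 0 1. q z = 0) \<and> (\<forall>z\<in>ball 0 1. q' z = 0)")
  case True
  then show ?thesis using balanced_factors_zero[OF b1 _ z] balanced_factors_zero[OF b2 _ z] z by auto
next
  case False
  have hol: "(\<lambda>z. p z * q z) holomorphic_on ball 0 1"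
    using b1 by (intro holomorphic_intros) (auto simp: balanced_factors_def)
  have feq: "f z = p z * q z" "f z = p' z * q' z" if "cmod z < 1" for z
    using b1 b2 that by (auto simp: balanced_factors_def)
  have hf: "f holomorphic_on ball 0 1"
    using hol by (rule holomorphic_transform) (simp add: feq)
  have f1: "cmod (f z) \<le> 1" if "cmod z < 1" for z
    unfolding feq(1)[OF that] norm_mult using b1 that by (intro mult_le_one) (auto simp: balanced_factors_def)
  obtain \<phi> where "integrable circ \<phi>" "AE t in circ. cmod (\<phi> t) \<le> 1"
      "AE t in circ. ((\<lambda>r. f (of_real r * cis t)) \<longlongrightarrow> \<phi> t) (at_left 1)"
    using bounded_holomorphic_boundary_le[OF hf f1] by blast
  then have \<phi>: "integrable circ \<phi>" "AE t in circ. ((\<lambda>r. f (of_real r * cis t)) \<longlongrightarrow> \<phi> t) (at_left 1)"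
    by simp_all
  have "outer q \<or> outer q'" using False b1 b2 unfolding balanced_factors_def by blast
  then have nz: "AE t in circ. \<phi> t \<noteq> 0"
    by (elim disjE) (rule balanced_factors_outer(1)[OF b1 _ \<phi>] balanced_factors_outer(1)[OF b2 _ \<phi>]; assumption)+
  have "\<exists>z\<in>ball 0 1. f z \<noteq> 0"
  proof (rule ccontr)
    assume "\<not> ?thesis"
    then have f0: "f z = 0" if "cmod z < 1" for z using that by auto
    \<comment> \<open>If \<open>f\<close> vanished, so would \<open>\<phi>\<close> almost
      everywhere; the whole circle would be a null set, against its length
      \<open>2*pi\<close>.\<close>
    have af: "AE t in circ. False"
      using nz \<phi>(2)
    proof eventually_elim
      case (elim t)
      have "\<forall>\<^sub>F r in at_left 1. f (of_real r * cis t) = 0"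
        using eventually_radius[of t] by eventually_elim (rule f0)
      then have "((\<lambda>r. f (of_real r * cis t)) \<longlongrightarrow> 0) (at_left 1)" by (rule tendsto_eventually)
      with elim(2) have "\<phi> t = 0" by (rule radial_limit_unique)
      with elim(1) show ?case by simp
    qed
    have eq: "{t \<in> space circ. \<not> False} = space circ" by auto
    have "emeasure circ (space circ) = 0" by (rule iffD1[OF AE_iff_measurable[OF sets.top eq] af])
    then have "measure circ {0..2*pi} = 0" by (simp add: measure_def)
    then show False unfolding measure_circ by simp
  qed
  then obtain z1 where z1: "z1 \<in> ball 0 1" "f z1 \<noteq> 0" by blast
  then have "q z1 \<noteq> 0" "q' z1 \<noteq> 0" using feq[of z1] by auto
  then have oq: "outer q" and oq': "outer q'" using b1 b2 z1(1) unfolding balanced_factors_def by blast+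
  have q: "q z = outer_exp (\<lambda>t. ln (cmod (\<phi> t)) / 2) z" "q' z = outer_exp (\<lambda>t. ln (cmod (\<phi> t)) / 2) z"
    by (rule balanced_factors_outer(2)[OF b1 oq \<phi> z]) (rule balanced_factors_outer(2)[OF b2 oq' \<phi> z])
  have "p z * q z = p' z * q' z" using feq[OF z] by metis
  then show ?thesis unfolding q by simp
qed

lemma balanced_factors_exist:
  assumes f: "f holomorphic_on ball 0 1" and f1: "\<And>z. cmod z < 1 \<Longrightarrow> cmod (f z) \<le> 1"
  obtains p q where "balanced_factors f p q"
proof (cases "\<forall>z\<in>ball 0 1. f z = 0")
  case True
  then have "balanced_factors f (\<lambda>_. 0) (\<lambda>_. 0)"
    by (auto simp: balanced_factors_def)
  then show ?thesis using that by blast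
next
  case False
  then obtain z0 where z0: "cmod z0 < 1" "f z0 \<noteq> 0" by auto
  obtain \<phi> where \<phi>: "integrable circ \<phi>" "AE t in circ. cmod (\<phi> t) \<le> 1"
      "AE t in circ. ((\<lambda>r. f (of_real r * cis t)) \<longlongrightarrow> \<phi> t) (at_left 1)"
    using bounded_holomorphic_boundary_le[OF f f1] by blast
  have nz: "AE t in circ. \<phi> t \<noteq> 0" by (rule log_boundary_integrable(1)[OF f f1 z0 \<phi>(1,3)])
  have int: "integrable circ (\<lambda>t. ln (cmod (\<phi> t)))" by (rule log_boundary_integrable(2)[OF f f1 z0 \<phi>(1,3)])
  have le: "cmod (f z) \<le> cmod (outer_exp (\<lambda>t. ln (cmod (\<phi> t))) z)" if "cmod z < 1" for z
    by (rule log_boundary_integrable(3)[OF f f1 z0 \<phi>(1,3) that])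
  \<comment> \<open>Half the logarithm, so that the square of \<open>q\<close> is the outer function
    dominating \<open>f\<close>.\<close>
  define u where "u t = ln (cmod (\<phi> t)) / 2" for t
  have u: "integrable circ u" unfolding u_def using int by simp
  define q where "q = outer_exp u"
  define p where "p z = f z / q z" for z
  have q: "q holomorphic_on ball 0 1" unfolding q_def by (rule outer_exp_holomorphic[OF u])
  have p: "p holomorphic_on ball 0 1" unfolding p_def by (intro holomorphic_on_divide f q) (simp add: q_def)
  have "AE t in circ. u t \<le> 0"
    using \<phi>(2) nz by eventually_elim (simp add: u_def)
  from norm_outer_exp_le[OF u _ this] have q1: "cmod (q z) \<le> 1" if "cmod z < 1" for z
    using that by (simp add: q_def)
  have p1: "cmod (p z) \<le> 1" if z: "cmod z < 1" for z
  proof -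
    have "cmod (f z) \<le> (cmod (q z))\<^sup>2"
      using le[OF z] outer_exp_half_sq[of "\<lambda>t. ln (cmod (\<phi> t))" z]
      unfolding norm_power[symmetric] q_def u_def[abs_def] by simp
    also have "\<dots> \<le> cmod (q z)" using q1[OF z] by (simp add: power2_eq_square mult_left_le)
    finally show ?thesis by (simp add: p_def norm_divide q_def divide_le_eq)
  qed
  obtain \<kappa> where \<kappa>: "AE t in circ. ((\<lambda>r. q (of_real r * cis t)) \<longlongrightarrow> \<kappa> t) (at_left 1)"
    using bounded_holomorphic_boundary[OF q q1] by blast
  have "AE t in circ. cmod (radial_limit p (cis t)) = cmod (radial_limit q (cis t))"
    using \<kappa> \<phi>(3) nz outer_exp_radial_limit[OF u]
  proof eventually_elim
    case (elim t)
    have "cmod (\<kappa> t) = exp (u t)"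
      using tendsto_norm[OF elim(1)] elim(4) unfolding q_def by (rule radial_limit_unique)
    \<comment> \<open>On the circle the squared modulus of \<open>q\<close> is that of
      \<open>f\<close>, so the quotient \<open>f / q\<close> has the modulus of
      \<open>q\<close>.\<close>
    then have "(cmod (\<kappa> t))\<^sup>2 = exp (2 * u t)" by (simp add: exp_double)
    then have k: "(cmod (\<kappa> t))\<^sup>2 = cmod (\<phi> t)" using elim(3) by (simp add: u_def)
    then have \<kappa>0: "\<kappa> t \<noteq> 0" using elim(3) by auto
    have "radial_limit p (cis t) = \<phi> t / \<kappa> t"
      unfolding p_def by (intro radial_limit_eqI tendsto_divide elim \<kappa>0)
    moreover have "cmod (\<phi> t / \<kappa> t) = cmod (\<kappa> t)"
      unfolding norm_divide k[symmetric] using \<kappa>0 by (simp add: power2_eq_square)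
    ultimately show ?case unfolding radial_limit_eqI[OF elim(1)] by simp
  qed
  moreover have "outer q"
    unfolding outer_iff_outer_exp
  proof (intro conjI)
    show "bounded (q ` ball 0 1)" using q1 by (intro boundedI[where B=1]) auto
    have [measurable]: "u \<in> borel_measurable circ" using u by auto
    show "\<exists>c \<psi>. cmod c = 1 \<and> (\<forall>t\<in>{0..2*pi}. 0 < \<psi> t) \<and> \<psi> \<in> borel_measurable circ \<and>
        integrable circ (\<lambda>t. ln (\<psi> t)) \<and> (\<forall>z\<in>ball 0 1. q z = c * outer_exp (\<lambda>t. ln (\<psi> t)) z)"
      using u by (intro exI[of _ 1] exI[of _ "\<lambda>t. exp (u t)"]) (auto simp: q_def)
  qed (rule q)
  moreover have "q 0 \<in> \<real>\<^sub>\<ge>\<^sub>0" unfolding q_def outer_exp_zero by (simp only: nonneg_Reals_of_real_iff exp_ge_zero)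
  moreover have "f z = p z * q z" for z by (simp add: p_def q_def)
  ultimately have "balanced_factors f p q"
    using p q p1 q1 by (auto simp: balanced_factors_def)
  then show ?thesis using that by blast
qed

section \<open>Contractivity of the lift and the final assembly\<close>

lemma norm_cauchy_schwarz_2:
  fixes a b c d :: complex
  shows "cmod (cnj a * c + cnj b * d) \<le> sqrt ((cmod a)\<^sup>2 + (cmod b)\<^sup>2) * sqrt ((cmod c)\<^sup>2 + (cmod d)\<^sup>2)"
proof -
  have "cmod (cnj a * c + cnj b * d) \<le> cmod a * cmod c + cmod b * cmod d"
    using norm_triangle_ineq[of "cnj a * c" "cnj b * d"] by (simp add: norm_mult)
  also have "\<dots> \<le> sqrt ((cmod a)\<^sup>2 + (cmod b)\<^sup>2) * sqrt ((cmod c)\<^sup>2 + (cmod d)\<^sup>2)"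
  proof (rule power2_le_imp_le)
    \<comment> \<open>Lagrange's identity: after squaring, the two sides differ by this
      square.\<close>
    have "0 \<le> (cmod a * cmod d - cmod b * cmod c)\<^sup>2" by simp
    then show "(cmod a * cmod c + cmod b * cmod d)\<^sup>2 \<le> (sqrt ((cmod a)\<^sup>2 + (cmod b)\<^sup>2) * sqrt ((cmod c)\<^sup>2 + (cmod d)\<^sup>2))\<^sup>2"
      unfolding power_mult_distrib by (simp add: power2_eq_square algebra_simps)
  qed simp
  finally show ?thesis .
qed

lemma schur_if_balanced:
  fixes x :: "complex \<Rightarrow> complex^3" and F :: "complex \<Rightarrow> complex^2^2"
  assumes x: "x \<in> Hol_tetrablock"
    and b: "balanced_factors (\<lambda>z. x z $ 1 * x z $ 2 - x z $ 3) (\<lambda>z. F z $ 1 $ 2) (\<lambda>z. F z $ 2 $ 1)"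
    and F: "\<And>z. F z $ 1 $ 1 = x z $ 1" "\<And>z. F z $ 2 $ 2 = x z $ 2"
  shows "F \<in> schur_class"
proof -
  have hx: "(\<lambda>z. x z $ i) holomorphic_on ball 0 1" for i using x by (simp add: Hol_tetrablock_def)
  have mem: "x z \<in> closed_tetrablock" if "cmod z < 1" for z
    using x that by (auto simp: Hol_tetrablock_def)
  note bounds = closed_tetrablock_bounds[OF mem]
  have holF: "(\<lambda>z. F z $ i $ j) holomorphic_on ball 0 1" for i j
  proof -
    have "\<forall>i j. (\<lambda>z. F z $ i $ j) holomorphic_on ball 0 1"
      using b hx by (simp add: forall_2 F balanced_factors_def)
    then show ?thesis by blast
  qed
  have F1: "cmod (F z $ i $ j) \<le> 1" if z: "cmod z < 1" for z i j
  proof -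
    have "\<forall>i j. cmod (F z $ i $ j) \<le> 1"
      using b bounds[OF z] z by (simp add: forall_2 F balanced_factors_def)
    then show ?thesis by blast
  qed
  obtain a where a: "AE t in circ. ((\<lambda>r. x (of_real r * cis t) $ 1) \<longlongrightarrow> a t) (at_left 1)"
    using bounded_holomorphic_boundary[OF hx bounds(1)] by blast
  obtain d where d: "AE t in circ. ((\<lambda>r. x (of_real r * cis t) $ 2) \<longlongrightarrow> d t) (at_left 1)"
    using bounded_holomorphic_boundary[OF hx bounds(2)] by blast
  obtain e where e: "AE t in circ. ((\<lambda>r. x (of_real r * cis t) $ 3) \<longlongrightarrow> e t) (at_left 1)"
    using bounded_holomorphic_boundary[OF hx bounds(3)] by blast
  obtain \<pi> \<kappa> where \<pi>: "AE t in circ. ((\<lambda>r. F (of_real r * cis t) $ 1 $ 2) \<longlongrightarrow> \<pi> t) (at_left 1) \<and>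
       ((\<lambda>r. F (of_real r * cis t) $ 2 $ 1) \<longlongrightarrow> \<kappa> t) (at_left 1) \<and> cmod (\<pi> t) = cmod (\<kappa> t)"
    using balanced_factors_boundary[OF b] by blast
  have contr: "AE t in circ. \<forall>v w. (cmod (a t * v + \<pi> t * w))\<^sup>2 + (cmod (\<kappa> t * v + d t * w))\<^sup>2 \<le> (cmod v)\<^sup>2 + (cmod w)\<^sup>2"
    using a d e \<pi>
  proof eventually_elim
    case (elim t)
    let ?x = "\<lambda>r. x (of_real r * cis t)"
    let ?F = "\<lambda>r. F (of_real r * cis t)"
    \<comment> \<open>The tetrablock inequality is not strict and survives radial limits; the
      factorisation identifies \<open>e t\<close> with the determinant of the limit matrix.\<close>
    have l1: "((\<lambda>r. ?x r $ 1 * ?x r $ 2 - ?x r $ 3) \<longlongrightarrow> a t * d t - e t) (at_left 1)"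
      using elim by (intro tendsto_intros) auto
    have l2: "((\<lambda>r. ?F r $ 1 $ 2 * ?F r $ 2 $ 1) \<longlongrightarrow> \<pi> t * \<kappa> t) (at_left 1)"
      using elim by (intro tendsto_intros) auto
    have "\<forall>\<^sub>F r in at_left 1. ?x r $ 1 * ?x r $ 2 - ?x r $ 3 = ?F r $ 1 $ 2 * ?F r $ 2 $ 1"
      using eventually_radius[of t] by eventually_elim (use b in \<open>simp add: balanced_factors_def\<close>)
    from tendsto_cong[OF this] l1 have "((\<lambda>r. ?F r $ 1 $ 2 * ?F r $ 2 $ 1) \<longlongrightarrow> a t * d t - e t) (at_left 1)" by simp
    then have "a t * d t - e t = \<pi> t * \<kappa> t" using l2 by (rule radial_limit_unique)
    then have et: "e t = a t * d t - \<pi> t * \<kappa> t" "\<pi> t * \<kappa> t = a t * d t - e t" by (auto simp: algebra_simps)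
    have "\<forall>\<^sub>F r in at_left 1. cmod (?x r $ 3) \<le> 1"
      using eventually_radius[of t] by eventually_elim (rule bounds)
    with tendsto_norm[OF elim(3)] have e1: "cmod (e t) \<le> 1" by (rule tendsto_upperbound) simp
    have r1: "((\<lambda>r. 1 - (cmod (?x r $ 1))\<^sup>2 - (cmod (?x r $ 2))\<^sup>2 + (cmod (?x r $ 3))\<^sup>2) \<longlongrightarrow>
       1 - (cmod (a t))\<^sup>2 - (cmod (d t))\<^sup>2 + (cmod (e t))\<^sup>2) (at_left 1)"
      using elim by (intro tendsto_intros) auto
    have r2: "((\<lambda>r. 2 * cmod (?x r $ 1 * ?x r $ 2 - ?x r $ 3)) \<longlongrightarrow> 2 * cmod (a t * d t - e t)) (at_left 1)"
      by (intro tendsto_intros l1)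
    have ev: "\<forall>\<^sub>F r in at_left 1. 2 * cmod (?x r $ 1 * ?x r $ 2 - ?x r $ 3) \<le>
        1 - (cmod (?x r $ 1))\<^sup>2 - (cmod (?x r $ 2))\<^sup>2 + (cmod (?x r $ 3))\<^sup>2"
      using eventually_radius[of t] by eventually_elim (rule bounds)
    have "2 * cmod (\<pi> t * \<kappa> t) \<le> 1 - (cmod (a t))\<^sup>2 - (cmod (d t))\<^sup>2 + (cmod (e t))\<^sup>2"
      unfolding et(2) by (rule tendsto_le[OF trivial_limit_at_left_real r1 r2 ev])
    then show ?case using elim(4) e1 unfolding et(1)
      by (intro allI contraction_if_tetrablock) auto
  qed
  have "norm (F l *v v) \<le> norm v" if l: "cmod l < 1" for l and v :: "complex^2"
  proof -
    \<comment> \<open>\<open>w\<close> is frozen at the point \<open>l\<close>. Then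
      \<open>g\<close> is holomorphic with \<open>g l = (norm w)^2\<close>, and the boundary bound
      \<open>norm w * norm v\<close> yields the claim after division by
      \<open>norm w\<close>.\<close>
    define w where "w = F l *v v"
    define g where "g z = cnj (w$1) * (F z $ 1 $ 1 * v$1 + F z $ 1 $ 2 * v$2) + cnj (w$2) * (F z $ 2 $ 1 * v$1 + F z $ 2 $ 2 * v$2)" for z
    have hg: "g holomorphic_on ball 0 1"
      unfolding g_def by (intro holomorphic_intros holF)
    \<comment> \<open>A crude bound; it serves only to make the maximum principle
      applicable.\<close>
    have bg: "cmod (g z) \<le> (cmod (w$1) + cmod (w$2)) * (cmod (v$1) + cmod (v$2))" if z: "cmod z < 1" for z
    proof -
      have "cmod (F z $ i $ j * u) \<le> cmod u" for i j u
        unfolding norm_mult using F1[OF z] by (intro mult_left_le_one_le) auto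
      then have row: "cmod (F z $ i $ 1 * v$1 + F z $ i $ 2 * v$2) \<le> cmod (v$1) + cmod (v$2)" for i
        by (intro norm_triangle_le add_mono)
      have "cmod (g z) \<le> cmod (cnj (w$1)) * cmod (F z $ 1 $ 1 * v$1 + F z $ 1 $ 2 * v$2) +
          cmod (cnj (w$2)) * cmod (F z $ 2 $ 1 * v$1 + F z $ 2 $ 2 * v$2)"
        unfolding g_def norm_mult[symmetric] by (rule norm_triangle_ineq)
      also have "\<dots> \<le> cmod (w$1) * (cmod (v$1) + cmod (v$2)) + cmod (w$2) * (cmod (v$1) + cmod (v$2))"
        unfolding complex_mod_cnj by (intro add_mono mult_left_mono row norm_ge_zero)
      finally show ?thesis by (simp add: distrib_right)
    qed
    have "AE t in circ. \<exists>k. ((\<lambda>r. g (of_real r * cis t)) \<longlongrightarrow> k) (at_left 1) \<and> cmod k \<le> norm w * norm v"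
      using a d \<pi> contr
    proof eventually_elim
      case (elim t)
      define k1 k2 where "k1 = a t * v$1 + \<pi> t * v$2" and "k2 = \<kappa> t * v$1 + d t * v$2"
      have "((\<lambda>r. g (of_real r * cis t)) \<longlongrightarrow> cnj (w$1) * k1 + cnj (w$2) * k2) (at_left 1)"
        unfolding g_def k1_def k2_def F using elim by (intro tendsto_intros) auto
      moreover have "cmod (cnj (w$1) * k1 + cnj (w$2) * k2) \<le> norm w * norm v"
      proof -
        have "(cmod k1)\<^sup>2 + (cmod k2)\<^sup>2 \<le> (norm v)\<^sup>2"
          using elim(4) unfolding k1_def k2_def norm_vec2_sq by blast
        then have s: "sqrt ((cmod k1)\<^sup>2 + (cmod k2)\<^sup>2) \<le> norm v" by (simp add: real_le_lsqrt)
        have "cmod (cnj (w$1) * k1 + cnj (w$2) * k2) \<le> sqrt ((norm w)\<^sup>2) * sqrt ((cmod k1)\<^sup>2 + (cmod k2)\<^sup>2)"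
          unfolding norm_vec2_sq by (rule norm_cauchy_schwarz_2)
        also have "\<dots> \<le> norm w * norm v" using s by (simp add: mult_left_mono)
        finally show ?thesis .
      qed
      ultimately show ?case by blast
    qed
    from bounded_holomorphic_max_principle[OF hg bg this l] have "cmod (g l) \<le> norm w * norm v" .
    moreover have "g l = of_real ((norm w)\<^sup>2)"
    proof -
      have "g l = cnj (w$1) * w$1 + cnj (w$2) * w$2" by (simp add: g_def w_def matrix_vector_mult_2)
      then show ?thesis unfolding norm_vec2_sq of_real_add complex_norm_square by (simp only: mult.commute)
    qed
    then have "cmod (g l) = (norm w)\<^sup>2" by (simp only: norm_of_real abs_power2)
    ultimately have "norm w * norm w \<le> norm w * norm v" by (simp add: power2_eq_square)
    then show ?thesis unfolding w_def[symmetric] by (cases "w = 0") (simp_all add: mult_le_cancel_left_pos)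
  qed
  then show ?thesis using holF unfolding schur_class_def onorm_le_one_iff by simp
qed

text \<open>The determinant condition gives the factorisation, and entries of a contraction have
  modulus at most 1. Uniqueness of lifts thereby reduces to
  \<open>balanced_factors_unique\<close>.\<close>

lemma tetrablock_lift_balanced:
  fixes x :: "complex \<Rightarrow> complex^3" and G :: "complex \<Rightarrow> complex^2^2"
  assumes "tetrablock_lift x G"
  shows "balanced_factors (\<lambda>z. x z $ 1 * x z $ 2 - x z $ 3) (\<lambda>z. G z $ 1 $ 2) (\<lambda>z. G z $ 2 $ 1)"
    and "\<And>z. cmod z < 1 \<Longrightarrow> G z $ 1 $ 1 = x z $ 1 \<and> G z $ 2 $ 2 = x z $ 2"
proof -
  have xG: "x z = vector [G z $ 1 $ 1, G z $ 2 $ 2, det (G z)]" if "cmod z < 1" for z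
    using assms that by (simp add: tetrablock_lift_def)
  show "G z $ 1 $ 1 = x z $ 1 \<and> G z $ 2 $ 2 = x z $ 2" if "cmod z < 1" for z
    using xG[OF that] by (simp add: vector_3)
  have "x z $ 1 * x z $ 2 - x z $ 3 = G z $ 1 $ 2 * G z $ 2 $ 1" if "cmod z < 1" for z
    using xG[OF that] by (simp add: vector_3 det_2)
  then show "balanced_factors (\<lambda>z. x z $ 1 * x z $ 2 - x z $ 3) (\<lambda>z. G z $ 1 $ 2) (\<lambda>z. G z $ 2 $ 1)"
    using assms by (auto simp: tetrablock_lift_def balanced_factors_def schur_class_def entry_le_one)
qed

theorem theorem7p1:
  fixes x :: "complex \<Rightarrow> complex^3"
  assumes "x \<in> Hol_tetrablock"
  shows "\<exists>F :: complex \<Rightarrow> complex^2^2.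
    tetrablock_lift x F \<and>
    (\<forall>G. tetrablock_lift x G \<longrightarrow> (\<forall>l\<in>ball 0 1. G l = F l)) \<and>
    (\<forall>m\<in>ball 0 1. \<forall>l\<in>ball 0 1. \<forall>w z.
       1 - F m $ 2 $ 2 * w \<noteq> 0 \<longrightarrow> 1 - F l $ 2 $ 2 * z \<noteq> 0 \<longrightarrow>
       1 - cnj (Psi w (x m)) * Psi z (x l) =
         (1 - cnj w * z) * cnj (gamma_F F m w) * gamma_F F l z +
         sesq (eta_F F m w) ((mat 1 - conj_transpose (F m) ** F l) *v eta_F F l z))"
proof -
  define f where "f z = x z $ 1 * x z $ 2 - x z $ 3" for z
  have hx: "(\<lambda>z. x z $ i) holomorphic_on ball 0 1" for i using assms by (simp add: Hol_tetrablock_def)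
  have hf: "f holomorphic_on ball 0 1" unfolding f_def by (intro holomorphic_intros hx)
  \<comment> \<open>From \<open>2 * cmod (f z) \<le> 1 + (cmod (x z $ 3))^2 \<le> 2\<close>.\<close>
  have f1: "cmod (f z) \<le> 1" if z: "cmod z < 1" for z
  proof -
    have "x z \<in> closed_tetrablock" using assms z by (auto simp: Hol_tetrablock_def)
    note b = closed_tetrablock_bounds[OF this]
    have "(cmod (x z $ 3))\<^sup>2 \<le> 1" using b(3) by (simp add: power_le_one)
    then show ?thesis
      using b(4) zero_le_power2[of "cmod (x z $ 1)"] zero_le_power2[of "cmod (x z $ 2)"]
      unfolding f_def by linarith
  qed
  obtain p q where pq: "balanced_factors f p q" using balanced_factors_exist[OF hf f1] by blast
  define F :: "complex \<Rightarrow> complex^2^2" where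
    "F z = vector [vector [x z $ 1, p z], vector [q z, x z $ 2]]" for z
  have F: "F z $ 1 $ 1 = x z $ 1" "F z $ 2 $ 2 = x z $ 2" "F z $ 1 $ 2 = p z" "F z $ 2 $ 1 = q z" for z
    by (simp_all add: F_def)
  have b: "balanced_factors (\<lambda>z. x z $ 1 * x z $ 2 - x z $ 3) (\<lambda>z. F z $ 1 $ 2) (\<lambda>z. F z $ 2 $ 1)"
    using pq unfolding F f_def[symmetric] by simp
  have schur: "F \<in> schur_class" by (rule schur_if_balanced[OF assms b F(1,2)])
  have xF: "x z = vector [F z $ 1 $ 1, F z $ 2 $ 2, det (F z)]" if z: "cmod z < 1" for z
  proof -
    have "x z $ 1 * x z $ 2 - x z $ 3 = p z * q z"
      using pq z by (simp add: balanced_factors_def f_def)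
    then have "x z $ 3 = x z $ 1 * x z $ 2 - p z * q z" by (simp add: algebra_simps)
    then show ?thesis by (simp add: vec_eq_iff forall_3 det_2 F)
  qed
  have lift: "tetrablock_lift x F"
    unfolding tetrablock_lift_def F(3,4) using schur xF pq by (auto simp: balanced_factors_def)
  have uniq: "G l = F l" if G: "tetrablock_lift x G" and l: "cmod l < 1" for G l
    using balanced_factors_unique[OF tetrablock_lift_balanced(1)[OF G] b l] tetrablock_lift_balanced(2)[OF G l]
    by (simp add: vec_eq_iff forall_2 F)
  show ?thesis
  proof (intro exI[of _ F] conjI lift allI ballI impI)
    show "G l = F l" if "tetrablock_lift x G" "l \<in> ball 0 1" for G l
      by (rule uniq) (use that in auto)
  qed (rule realization_identity; (rule xF)?; simp)
qed

end
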